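(* Let $d\ge2$ be an integer. (a) The number of complete intersection Jordan types of diagonal lengths $$T=\left(1_0,2_1,\ldots,(d-1)_{d-2},d_{d-1},(d-1)_d,\ldots,2_{2d-3},1_{2d-2}\right)$$ is equal to $2^{d-1}$. (b) Let $k\ge2$. The number of complete intersection Jordan types of diagonal lengths $$T=\left(1_0,2_1,\ldots,(d-1)_{d-2},d_{d-1},\ldots,d_{d+k-2},(d-1)_{d+k-1},\ldots,2_{2d-4+k},1_{2d-3+k}\right)$$ is equal to $2^d$. (Subscripts indicate the degree in which each value of $T$ occurs.)
   Context: Let $R=\mathsf k[x,y]$ with its standard grading, where the field $\mathsf k$ has characteristic zero, or is infinite of characteristic $p$ greater than the socle degree of $T$ (the largest degree in which $T$ is nonzero). For a partition $P=(p_1\ge\cdots\ge p_m)$ let $C_P$ be the set of monomials $x^ay^b$ with $0\le b<m$, $0\le a<p_{b+1}$, and $E_P$ the set of monomials not in $C_P$, and also the monomial ideal they generate. The diagonal lengths of $P$ is the Hilbert function of $R/E_P$. The initial monomial of a form is its monomial of highest $y$-degree with nonzero coefficient; $\mathrm{in}(I)$ is generated by the initial monomials of elements of $I$; the Jordan cell $\mathbb V(E_P)$ is the affine variety (an affine space) parametrizing all graded ideals $I\subset R$ with $\mathrm{in}(I)=E_P$. $\kappa(P)$ is the minimum number of generators of a generic ideal $I\in\mathbb V(E_P)$ (generic: in a suitable nonempty Zariski-open dense subset). A complete intersection Jordan type of diagonal lengths $T$ is a partition $P$ of diagonal lengths $T$ such that $\kappa(P)=2$. *)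

theory Defs
  imports
    "HOL-Analysis.Function_Topology"
    "HOL-Computational_Algebra.Polynomial"
    "HOL-Library.More_List"
begin

text \<open>
  The ring k[x,y] is represented as k[x][y], i.e. by the type \<open>'a poly poly\<close> whose outer
  variable is y. A monomial x^a y^b is encoded by its exponent pair (a, b).
\<close>

type_synonym expo = "nat \<times> nat"

definition mono_xy :: "expo \<Rightarrow> 'a::field poly poly" where
  "mono_xy = (\<lambda>(a, b). monom (monom 1 a) b)"

definition coef_xy :: "'a::field poly poly \<Rightarrow> expo \<Rightarrow> 'a" where
  "coef_xy f = (\<lambda>(a, b). coeff (coeff f b) a)"


subsection \<open>Graded ideals and Hilbert functions\<close>

definition forms :: "nat \<Rightarrow> 'a::field poly poly set" where
  "forms i = {f. \<forall>a b. coef_xy f (a, b) \<noteq> 0 \<longrightarrow> a + b = i}"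

definition hom_component :: "nat \<Rightarrow> 'a::field poly poly \<Rightarrow> 'a poly poly" where
  "hom_component i f = (\<Sum>b\<le>i. smult [:coef_xy f (i - b, b):] (mono_xy (i - b, b)))"

text \<open>Ideals are submodules of the ring over itself.\<close>

definition is_ideal :: "'a::field poly poly set \<Rightarrow> bool" where
  "is_ideal I \<longleftrightarrow> module.subspace (*) I"

definition ideal_gen :: "'a::field poly poly set \<Rightarrow> 'a poly poly set" where
  "ideal_gen S = module.span (*) S"

definition graded_ideal :: "'a::field poly poly set \<Rightarrow> bool" where
  "graded_ideal I \<longleftrightarrow> is_ideal I \<and> (\<forall>f\<in>I. \<forall>i. hom_component i f \<in> I)"

definition min_gens :: "'a::field poly poly set \<Rightarrow> nat" where
  "min_gens I = (LEAST n. \<exists>S. finite S \<and> card S = n \<and> ideal_gen S = I)"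

definition dim_k :: "'a::field poly poly set \<Rightarrow> nat" where
  "dim_k V = vector_space.dim (\<lambda>c. smult [:c:]) V"

text \<open>The Hilbert function of the quotient k[x,y]/I, for a graded ideal I.\<close>

definition hilbert_quot :: "'a::field poly poly set \<Rightarrow> nat \<Rightarrow> nat" where
  "hilbert_quot I i = dim_k (forms i :: 'a poly poly set) - dim_k (I \<inter> forms i)"


subsection \<open>Initial ideals\<close>

text \<open>
  For a nonzero form f, the coefficient of the highest power of y occurring in f is a scalar
  multiple of a power of x, so its degree in x is the exponent of x in the initial monomial.
\<close>

definition initial_monomial :: "'a::field poly poly \<Rightarrow> 'a poly poly" where
  "initial_monomial f = mono_xy (degree (lead_coeff f), degree f)"

definition initial_ideal :: "'a::field poly poly set \<Rightarrow> 'a poly poly set" where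
  "initial_ideal I = ideal_gen {initial_monomial f | f i. f \<in> I \<and> f \<in> forms i \<and> f \<noteq> 0}"


subsection \<open>Partitions and Jordan cells\<close>

definition is_partition :: "nat list \<Rightarrow> bool" where
  "is_partition P \<longleftrightarrow> sorted_wrt (\<ge>) P \<and> 0 \<notin> set P"

text \<open>The part p_{b+1} of P is the list element \<open>P ! b\<close>.\<close>

definition C_set :: "nat list \<Rightarrow> expo set" where
  "C_set P = {(a, b). b < length P \<and> a < P ! b}"

definition E_ideal :: "nat list \<Rightarrow> 'a::field poly poly set" where
  "E_ideal P = ideal_gen (mono_xy ` (- C_set P))"

definition has_diagonal_lengths :: "'a::field itself \<Rightarrow> nat list \<Rightarrow> (nat \<Rightarrow> nat) \<Rightarrow> bool" where
  "has_diagonal_lengths _ P T \<longleftrightarrow> hilbert_quot (E_ideal P :: 'a poly poly set) = T"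

definition jordan_cell :: "nat list \<Rightarrow> 'a::field poly poly set set" where
  "jordan_cell P = {I. graded_ideal I \<and> initial_ideal I = E_ideal P}"

text \<open>
  Coordinates on the cell. For I in the cell, the monomials of \<open>C_set P\<close> form a basis of
  k[x,y]/I; hence for each monomial \<open>\<mu>\<close> outside \<open>C_set P\<close> there is a unique element of I
  of the form \<open>\<mu> + (linear combination of monomials in C_set P)\<close>. These elements are the
  reduced echelon bases of the graded pieces of I, and their coefficients are the
  standard affine coordinates of the product of Schubert cells (one in each degree)
  of which the Jordan cell is a closed subvariety. Only finitely many coordinates
  are not identically zero on the cell.
\<close>

definition reduced_elem :: "nat list \<Rightarrow> 'a::field poly poly set \<Rightarrow> expo \<Rightarrow> 'a poly poly" where
  "reduced_elem P I \<mu> =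
     (THE f. f \<in> I \<and> (\<forall>\<nu>. \<nu> \<notin> C_set P \<longrightarrow> coef_xy f \<nu> = (if \<nu> = \<mu> then 1 else 0)))"

inductive_set regular_funs :: "nat list \<Rightarrow> ('a::field poly poly set \<Rightarrow> 'a) set"
  for P :: "nat list" where
  const: "(\<lambda>I. c) \<in> regular_funs P"
| coord: "\<mu> \<notin> C_set P \<Longrightarrow> \<nu> \<in> C_set P \<Longrightarrow> (\<lambda>I. coef_xy (reduced_elem P I \<mu>) \<nu>) \<in> regular_funs P"
| add: "\<phi> \<in> regular_funs P \<Longrightarrow> \<psi> \<in> regular_funs P \<Longrightarrow> (\<lambda>I. \<phi> I + \<psi> I) \<in> regular_funs P"
| mult: "\<phi> \<in> regular_funs P \<Longrightarrow> \<psi> \<in> regular_funs P \<Longrightarrow> (\<lambda>I. \<phi> I * \<psi> I) \<in> regular_funs P"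

text \<open>
  The Zariski topology on (the k-points of) the cell: the basic open sets are the loci
  where a polynomial in the coordinates does not vanish.
\<close>

definition zariski_cell :: "nat list \<Rightarrow> 'a::field poly poly set topology" where
  "zariski_cell P =
     topology_generated_by {{I \<in> jordan_cell P. \<phi> I \<noteq> 0} | \<phi>. \<phi> \<in> regular_funs P}"

definition generically :: "nat list \<Rightarrow> ('a::field poly poly set \<Rightarrow> bool) \<Rightarrow> bool" where
  "generically P Q \<longleftrightarrow>
     (\<exists>U. openin (zariski_cell P) U \<and> U \<noteq> {} \<and>
          zariski_cell P closure_of U = topspace (zariski_cell P) \<and> (\<forall>I\<in>U. Q I))"

text \<open>Two dense open sets meet, so at most one n qualifies below.\<close>

definition kappa :: "'a::field itself \<Rightarrow> nat list \<Rightarrow> nat" where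
  "kappa _ P = (THE n. generically P (\<lambda>I :: 'a poly poly set. min_gens I = n))"


subsection \<open>Complete intersection Jordan types\<close>

definition CI_jordan_types :: "'a::field itself \<Rightarrow> (nat \<Rightarrow> nat) \<Rightarrow> nat list set" where
  "CI_jordan_types K T = {P. is_partition P \<and> has_diagonal_lengths K P T \<and> kappa K P = 2}"

definition socle_degree :: "(nat \<Rightarrow> nat) \<Rightarrow> nat" where
  "socle_degree T = Max {i. T i \<noteq> 0}"

definition admissible_field :: "'a::field itself \<Rightarrow> (nat \<Rightarrow> nat) \<Rightarrow> bool" where
  "admissible_field _ T \<longleftrightarrow>
     CHAR('a) = 0 \<or> (infinite (UNIV :: 'a set) \<and> socle_degree T < CHAR('a))"

text \<open>
  The sequence (1, 2, ..., d-1, d, ..., d, d-1, ..., 2, 1) with d occurring k times,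
  starting in degree 0 and extended by zero.
\<close>

definition T_seq :: "nat \<Rightarrow> nat \<Rightarrow> nat \<Rightarrow> nat" where
  "T_seq d k = nth_default 0 ([1..<d] @ replicate k d @ rev [1..<d])"

end

theory Submission
  imports Defs
begin

text \<open>
  Write \<open>m\<close> for the length of \<open>P\<close>, \<open>r(b)\<close> for the number \<open>row P b\<close> of monomials of \<open>C\<^sub>P\<close> with exponent
  \<open>b\<close> of \<open>y\<close>, and \<open>e\<^sub>b = r(b) + b\<close> for the degree of the first monomial of this row outside \<open>C\<^sub>P\<close>.
  The proof has three parts.

  \<^emph>\<open>Geometry of the cell.\<close> An ideal of the cell is a free \<open>k[x]\<close>-module on elements
  \<open>x\<^bsup>r(b)\<^esup> g\<^sub>b\<close>, where \<open>g\<^sub>b\<close> is a form of degree \<open>b\<close>, monic in \<open>y\<close>. Being closed under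
  multiplication by \<open>y\<close> means
  \<open>g\<^sub>b\<^sub>+\<^sub>1 = y g\<^sub>b + \<Sum>\<^sub>j\<^sub>\<le>\<^sub>b c\<^sub>b\<^sub>j x\<^bsup>b+1-j\<^esup> g\<^sub>j\<close> with scalars \<open>c\<^sub>b\<^sub>j\<close> that vanish unless
  \<open>e\<^sub>j \<le> e\<^sub>b + 1\<close>, and these scalars are arbitrary (\<open>recur_ideal_in_cell\<close>, \<open>is_recur_ideal\<close>). On the
  line through two systems of scalars every regular function is a polynomial in the parameter, so
  over an infinite field any two nonempty open subsets of the cell meet (\<open>cell_irreducible\<close>).
  Generation by deformed generators is an open condition (\<open>min_gens_semicontinuous\<close>), and therefore
  the generic number of generators is the minimum over the cell (\<open>kappa_eq_min\<close>).

  \<^emph>\<open>Two generators.\<close> Let \<open>P\<close> have diagonal lengths \<open>T\<close>. Counting dimensions, every ideal of the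
  cell needs a generator in degree \<open>d\<close> and one in degree \<open>d + k - 1\<close> (two in degree \<open>d\<close> if
  \<open>k = 1\<close>). An element with initial monomial \<open>y\<^sup>m\<close> never lies in \<open>(x, y)I\<close>, because \<open>y\<^bsup>m-1\<^esup>\<close> is
  not an initial monomial, so degree \<open>m\<close> needs a generator, too. Hence \<open>\<kappa>(P) = 2\<close> forces
  \<open>m = d\<close> or \<open>m = d + k - 1\<close> (\<open>min_gens_lower_bound\<close>). For these \<open>m\<close>, having diagonal lengths \<open>T\<close> amounts to \<open>e\<^sub>0, \<dots>, e\<^sub>m\<^sub>-\<^sub>1\<close> being a
  rearrangement of the last \<open>m\<close> integers below \<open>2d + k - 1\<close>
  (\<open>diagonal_lengths_iff_staircase\<close>). If \<open>c\<^sub>b\<^sub>j\<close> is taken to be 1 exactly when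
  \<open>j \<le> b < m\<close> and \<open>e\<^sub>j = e\<^sub>b + 1\<close>, each basis element is obtained from one whose degree is smaller by one,
  and the ideal is generated by its basis element of least degree together with \<open>g\<^sub>m\<close>
  (\<open>staircase_complete_intersection\<close>). So the complete intersection Jordan types are the
  partitions of length \<open>d\<close> or \<open>d + k - 1\<close> with diagonal lengths \<open>T\<close> (\<open>CI_jordan_types_eq\<close>).

  \<^emph>\<open>Counting.\<close> Since \<open>e\<^sub>b\<^sub>+\<^sub>1 \<le> e\<^sub>b + 1\<close>, such a rearrangement is made of runs of consecutive integers,
  the first of which ends with the largest value. Removing the first run leaves an object of the
  same kind, whence there are \<open>2\<^bsup>d-1\<^esup>\<close> of them for either length (\<open>card_staircase\<close>). The two
  lengths agree for \<open>k = 1\<close> and differ for \<open>k \<ge> 2\<close>.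
\<close>

section \<open>Coefficients, forms and ideals\<close>

lemma (in module) span_image_finite:
  assumes "finite S" "f \<in> span (F ` S)"
  shows "\<exists>h. f = (\<Sum>s\<in>S. h s *s F s)"
  using assms
proof (induction S arbitrary: f)
  case (insert s S)
  from insert.prems obtain c where "f - c *s F s \<in> span (F ` S)"
    by (auto simp: span_insert)
  then obtain h where h: "f - c *s F s = (\<Sum>s\<in>S. h s *s F s)" using insert.IH by blast
  have "(\<Sum>t\<in>S. (h(s := c)) t *s F t) = (\<Sum>s\<in>S. h s *s F s)"
    using insert.hyps by (intro sum.cong) auto
  hence "f = (\<Sum>t\<in>insert s S. (h(s := c)) t *s F t)"
    using insert.hyps h by (simp add: algebra_simps)
  thus ?case by blast
qed simp

interpretation ring_mod: module "(*) :: 'a::comm_ring_1 \<Rightarrow> 'a \<Rightarrow> 'a"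
  by standard (auto simp: algebra_simps)

interpretation kx: module "smult :: 'a::field poly \<Rightarrow> 'a poly poly \<Rightarrow> 'a poly poly"
  by standard (auto simp: smult_add_right smult_add_left)

interpretation kvs: vector_space "\<lambda>c::'a::field. smult [:c:] :: 'a poly poly \<Rightarrow> 'a poly poly"
  by standard (auto simp: smult_add_right smult_add_left[symmetric] mult.commute simp flip: one_pCons)

abbreviation scal :: "'a::field \<Rightarrow> 'a poly poly \<Rightarrow> 'a poly poly" where
  "scal c \<equiv> smult [:c:]"

lemma coef_xy_simps [simp]:
  "coef_xy 0 \<nu> = 0"
  "coef_xy (f + g) \<nu> = coef_xy f \<nu> + coef_xy g \<nu>"
  "coef_xy (f - g) \<nu> = coef_xy f \<nu> - coef_xy g \<nu>"
  "coef_xy (- f) \<nu> = - coef_xy f \<nu>"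
  "coef_xy (scal c f) \<nu> = c * coef_xy f \<nu>"
  by (cases \<nu>; simp add: coef_xy_def)+

lemma coef_xy_sum [simp]: "coef_xy (sum f A) \<nu> = (\<Sum>i\<in>A. coef_xy (f i) \<nu>)"
  by (induction A rule: infinite_finite_induct) auto

lemma coef_xy_eqI: "(\<And>\<nu>. coef_xy f \<nu> = coef_xy g \<nu>) \<Longrightarrow> f = g"
  by (intro poly_eqI) (force simp: coef_xy_def)

lemma coef_xy_mono [simp]: "coef_xy (mono_xy \<mu>) \<nu> = (if \<mu> = \<nu> then 1 else 0)"
  by (cases \<mu>; cases \<nu>) (auto simp: coef_xy_def mono_xy_def)

lemma coef_xy_mono_mult:
  "coef_xy (mono_xy (i, j) * f) (a, b) =
     (if i \<le> a \<and> j \<le> b then coef_xy f (a - i, b - j) else 0)"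
  by (auto simp: coef_xy_def mono_xy_def coeff_monom_mult)

lemma coef_xy_smult_monom:
  "coef_xy (smult (monom c i) f) (a, b) = (if i \<le> a then c * coef_xy f (a - i, b) else 0)"
  by (auto simp: coef_xy_def coeff_monom_mult)

lemma finite_support: "finite {\<nu>. coef_xy f \<nu> \<noteq> 0}"
proof -
  have "{\<nu>. coef_xy f \<nu> \<noteq> 0} \<subseteq> (\<Union>b\<le>degree f. {..degree (coeff f b)} \<times> {b})"
    by (auto simp: coef_xy_def intro: le_degree) (metis coeff_0 le_degree | auto intro: le_degree)+
  thus ?thesis by (rule finite_subset) auto
qed

lemma mono_expansion:
  assumes "finite A" "\<And>\<nu>. coef_xy f \<nu> \<noteq> 0 \<Longrightarrow> \<nu> \<in> A"
  shows "f = (\<Sum>\<nu>\<in>A. scal (coef_xy f \<nu>) (mono_xy \<nu>))"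
proof (rule coef_xy_eqI)
  fix \<mu>
  have "(\<Sum>\<nu>\<in>A. coef_xy f \<nu> * (if \<nu> = \<mu> then 1 else 0)) = (if \<mu> \<in> A then coef_xy f \<mu> else 0)"
    using assms(1) by (simp add: sum.delta' if_distrib [of "\<lambda>x. _ * x"] cong: if_cong)
  thus "coef_xy f \<mu> = coef_xy (\<Sum>\<nu>\<in>A. scal (coef_xy f \<nu>) (mono_xy \<nu>)) \<mu>"
    using assms(2)[of \<mu>] by auto
qed

lemma formsD: "f \<in> forms i \<Longrightarrow> coef_xy f (a, b) \<noteq> 0 \<Longrightarrow> a + b = i"
  by (auto simp: forms_def)

lemma forms_0 [simp]: "0 \<in> forms i" by (auto simp: forms_def)
lemma forms_add: "f \<in> forms i \<Longrightarrow> g \<in> forms i \<Longrightarrow> f + g \<in> forms i"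
  by (auto simp: forms_def) (metis add_0)
lemma forms_diff: "f \<in> forms i \<Longrightarrow> g \<in> forms i \<Longrightarrow> f - g \<in> forms i"
  by (simp add: forms_def) (metis diff_0_right)
lemma forms_scal: "f \<in> forms i \<Longrightarrow> scal c f \<in> forms i"
  by (auto simp: forms_def)
lemma forms_sum: "(\<And>j. j \<in> A \<Longrightarrow> f j \<in> forms i) \<Longrightarrow> sum f A \<in> forms i"
  by (induction A rule: infinite_finite_induct) (auto intro: forms_add)
lemma forms_mono: "a + b = i \<Longrightarrow> mono_xy (a, b) \<in> forms i"
  by (auto simp: forms_def split: if_splits)
lemma forms_mono_mult: "f \<in> forms i \<Longrightarrow> mono_xy (a, b) * f \<in> forms (a + b + i)"
  by (fastforce simp: forms_def coef_xy_mono_mult split: if_splits)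
lemma forms_smult_monom: "f \<in> forms i \<Longrightarrow> smult (monom c a) f \<in> forms (a + i)"
  by (fastforce simp: forms_def coef_xy_smult_monom split: if_splits)

lemma forms_mult: assumes "f \<in> forms i" "g \<in> forms j" shows "f * g \<in> forms (i + j)"
proof -
  let ?A = "{\<nu>. coef_xy f \<nu> \<noteq> 0}"
  have "f * g = (\<Sum>\<nu>\<in>?A. scal (coef_xy f \<nu>) (mono_xy \<nu> * g))"
    using arg_cong[OF mono_expansion[OF finite_support, of f f], of "\<lambda>f. f * g"]
    by (auto simp: sum_distrib_right)
  moreover have "mono_xy \<nu> * g \<in> forms (i + j)" if "\<nu> \<in> ?A" for \<nu>
    using formsD[OF assms(1), of "fst \<nu>" "snd \<nu>"] forms_mono_mult[OF assms(2), of "fst \<nu>" "snd \<nu>"] that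
    by (auto)
  ultimately show ?thesis by (auto intro!: forms_sum forms_scal)
qed

lemma coef_hom_component:
  "coef_xy (hom_component i f) (a, b) = (if a + b = i then coef_xy f (a, b) else 0)"
proof -
  have "coef_xy (hom_component i f) (a, b) =
    (\<Sum>b'\<le>i. if b' = b then (if i - b = a then coef_xy f (i - b, b) else 0) else 0)"
    unfolding hom_component_def coef_xy_sum by (rule sum.cong) auto
  also have "\<dots> = (if a + b = i then coef_xy f (a, b) else 0)"
    by (subst sum.delta) auto
  finally show ?thesis .
qed

lemma hom_component_forms [simp]: "hom_component i f \<in> forms i"
  by (auto simp: forms_def coef_hom_component split: if_splits)

lemma hom_component_form: "f \<in> forms j \<Longrightarrow> hom_component i f = (if i = j then f else 0)"
  by (rule coef_xy_eqI) (auto simp: coef_hom_component dest: formsD)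

lemma hom_component_add: "hom_component i (f + g) = hom_component i f + hom_component i g"
  by (rule coef_xy_eqI) (auto simp: coef_hom_component)
lemma hom_component_scal: "hom_component i (scal c f) = scal c (hom_component i f)"
  by (rule coef_xy_eqI) (auto simp: coef_hom_component)
lemma hom_component_0 [simp]: "hom_component i 0 = 0"
  by (rule coef_xy_eqI) (auto simp: coef_hom_component)
lemma hom_component_sum: "hom_component i (sum f A) = (\<Sum>j\<in>A. hom_component i (f j))"
  by (induction A rule: infinite_finite_induct) (auto simp: hom_component_add)

lemma hom_decomp: "\<exists>n. f = (\<Sum>i\<le>n. hom_component i f)"
proof -
  have "finite ((\<lambda>\<nu>. fst \<nu> + snd \<nu>) ` {\<nu>. coef_xy f \<nu> \<noteq> 0})" using finite_support by auto
  then obtain n where n: "\<forall>i\<in>(\<lambda>\<nu>. fst \<nu> + snd \<nu>) ` {\<nu>. coef_xy f \<nu> \<noteq> 0}. i \<le> n"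
    using finite_nat_set_iff_bounded_le by metis
  have "f = (\<Sum>i\<le>n. hom_component i f)"
  proof (rule coef_xy_eqI)
    fix \<nu> :: expo obtain a b where [simp]: "\<nu> = (a, b)" by (cases \<nu>)
    show "coef_xy f \<nu> = coef_xy (\<Sum>i\<le>n. hom_component i f) \<nu>"
      using n by (auto simp: coef_hom_component)
  qed
  thus ?thesis ..
qed

lemma hom_component_mult:
  assumes "g \<in> forms w"
  shows "hom_component v (h * g) = (if w \<le> v then hom_component (v - w) h * g else 0)"
proof -
  obtain n where n: "h = (\<Sum>i\<le>n. hom_component i h)" using hom_decomp by blast
  have "hom_component v (h * g) = (\<Sum>i\<le>n. hom_component v (hom_component i h * g))"
    using arg_cong[OF n, of "\<lambda>h. hom_component v (h * g)"]
    by (simp add: sum_distrib_right hom_component_sum)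
  also have "\<dots> = (\<Sum>i\<le>n. if v = i + w then hom_component i h * g else 0)"
    by (intro sum.cong refl) (auto simp: hom_component_form[OF forms_mult[OF hom_component_forms assms]])
  also have "\<dots> = (\<Sum>i\<le>n. if w \<le> v \<and> i = v - w then hom_component i h * g else 0)"
    by (intro sum.cong) auto
  also have "\<dots> = (if w \<le> v then (\<Sum>i\<le>n. hom_component (v - w) (hom_component i h)) * g else 0)"
    by (auto simp: hom_component_form[OF hom_component_forms] sum_distrib_right intro!: sum.cong)
  also have "(\<Sum>i\<le>n. hom_component (v - w) (hom_component i h)) = hom_component (v - w) h"
    using arg_cong[OF n, of "hom_component (v - w)"] by (simp add: hom_component_sum)
  finally show ?thesis .
qed

lemma is_idealI:
  "0 \<in> I \<Longrightarrow> (\<And>f g. f \<in> I \<Longrightarrow> g \<in> I \<Longrightarrow> f + g \<in> I) \<Longrightarrow> (\<And>h f. f \<in> I \<Longrightarrow> h * f \<in> I) \<Longrightarrow> is_ideal I"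
  by (auto simp: is_ideal_def ring_mod.subspace_def)

lemma is_ideal_gen [simp]: "is_ideal (ideal_gen S)"
  by (simp add: is_ideal_def ideal_gen_def ring_mod.subspace_span)

context fixes I :: "'a::field poly poly set" assumes I: "is_ideal I" begin
lemma ideal_0: "0 \<in> I" using I by (simp add: is_ideal_def ring_mod.subspace_0)
lemma ideal_add: "f \<in> I \<Longrightarrow> g \<in> I \<Longrightarrow> f + g \<in> I"
  using I by (simp add: is_ideal_def ring_mod.subspace_add)
lemma ideal_diff: "f \<in> I \<Longrightarrow> g \<in> I \<Longrightarrow> f - g \<in> I"
  using I by (simp add: is_ideal_def ring_mod.subspace_diff)
lemma ideal_mult: "f \<in> I \<Longrightarrow> h * f \<in> I"
  using I by (simp add: is_ideal_def ring_mod.subspace_scale)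
lemma ideal_smult: "f \<in> I \<Longrightarrow> smult c f \<in> I"
  using ideal_mult[of f "[:c:]"] by simp
lemma ideal_sum: "(\<And>j. j \<in> A \<Longrightarrow> f j \<in> I) \<Longrightarrow> sum f A \<in> I"
  by (induction A rule: infinite_finite_induct) (auto intro: ideal_add ideal_0)
end

lemma ideal_gen_superset: "S \<subseteq> ideal_gen S"
  by (simp add: ideal_gen_def ring_mod.span_superset)
lemma ideal_gen_least: "is_ideal I \<Longrightarrow> S \<subseteq> I \<Longrightarrow> ideal_gen S \<subseteq> I"
  by (simp add: ideal_gen_def is_ideal_def ring_mod.span_minimal)

lemma ideal_gen_finite:
  assumes "finite S" "f \<in> ideal_gen (F ` S)"
  obtains h where "f = (\<Sum>s\<in>S. h s * F s)"
  using ring_mod.span_image_finite[OF assms[unfolded ideal_gen_def]] by blast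

lemma ideal_gen_homogeneous:
  assumes "\<And>s. s \<in> S \<Longrightarrow> \<exists>w. s \<in> forms w" "f \<in> ideal_gen S"
  shows "hom_component i f \<in> ideal_gen S"
proof -
  have "ideal_gen S \<subseteq> {f \<in> ideal_gen S. \<forall>i. hom_component i f \<in> ideal_gen S}" (is "_ \<subseteq> ?J")
    unfolding ideal_gen_def
  proof
    fix f assume "f \<in> ring_mod.span S"
    thus "f \<in> {f \<in> ring_mod.span S. \<forall>i. hom_component i f \<in> ring_mod.span S}"
    proof (induction rule: ring_mod.span_induct_alt)
      case base show ?case by (auto simp: ring_mod.span_zero)
    next
      case (step h s g)
      then obtain w where w: "s \<in> forms w" using assms by blast
      have "s \<in> ring_mod.span S" using step by (simp add: ring_mod.span_base)
      thus ?case using step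
        by (auto simp: hom_component_add hom_component_mult[OF w] intro!: ring_mod.span_add ring_mod.span_scale)
    qed
  qed
  thus ?thesis using assms by auto
qed

section \<open>Monomial ideals and initial monomials\<close>

abbreviation row :: "nat list \<Rightarrow> nat \<Rightarrow> nat" where
  "row P b \<equiv> nth_default 0 P b"

text \<open>
  The degree of the first monomial of a row that lies outside the diagram.
\<close>

definition edeg :: "nat list \<Rightarrow> nat \<Rightarrow> nat" where
  "edeg P b = row P b + b"

lemma C_set_iff: "(a, b) \<in> C_set P \<longleftrightarrow> a < row P b"
  by (auto simp: C_set_def nth_default_def)

lemma row_antimono: "is_partition P \<Longrightarrow> i \<le> j \<Longrightarrow> row P j \<le> row P i"
  by (auto simp: is_partition_def nth_default_def sorted_wrt_iff_nth_less le_less)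

lemma row_pos_iff: "is_partition P \<Longrightarrow> 0 < row P b \<longleftrightarrow> b < length P"
  by (auto simp: is_partition_def nth_default_def in_set_conv_nth) (metis gr0I)?

lemma notin_C_set_mono:
  "is_partition P \<Longrightarrow> (a, b) \<notin> C_set P \<Longrightarrow> a \<le> a' \<Longrightarrow> b \<le> b' \<Longrightarrow> (a', b') \<notin> C_set P"
  using row_antimono[of P b b'] by (auto simp: C_set_iff)

text \<open>
  The rows of a partition weakly decrease, so the complement of the diagram is closed under
  multiplication by monomials and spans an ideal as it stands.
\<close>

lemma E_ideal_iff:
  assumes "is_partition P"
  shows "f \<in> E_ideal P \<longleftrightarrow> (\<forall>\<nu>. coef_xy f \<nu> \<noteq> 0 \<longrightarrow> \<nu> \<notin> C_set P)"
proof
  have "coef_xy f (a, b) \<noteq> 0 \<longrightarrow> (a, b) \<notin> C_set P" if "f \<in> E_ideal P" for a b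
    using that unfolding E_ideal_def ideal_gen_def
  proof (induction rule: ring_mod.span_induct_alt)
    case (step h s g)
    then obtain i j where s: "s = mono_xy (i, j)" "(i, j) \<notin> C_set P" by auto
    have "coef_xy (h * s) (a, b) \<noteq> 0 \<Longrightarrow> (a, b) \<notin> C_set P"
      using notin_C_set_mono[OF assms s(2)]
      by (auto simp: s(1) mult.commute[of h] coef_xy_mono_mult split: if_splits)
    thus ?case using step by auto
  qed auto
  thus "f \<in> E_ideal P \<Longrightarrow> \<forall>\<nu>. coef_xy f \<nu> \<noteq> 0 \<longrightarrow> \<nu> \<notin> C_set P" by auto
next
  assume *: "\<forall>\<nu>. coef_xy f \<nu> \<noteq> 0 \<longrightarrow> \<nu> \<notin> C_set P"
  have "f = (\<Sum>\<nu>\<in>{\<nu>. coef_xy f \<nu> \<noteq> 0}. scal (coef_xy f \<nu>) (mono_xy \<nu>))"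
    by (rule mono_expansion[OF finite_support]) auto
  also have "\<dots> \<in> E_ideal P" unfolding E_ideal_def
    by (intro ideal_sum ideal_smult is_ideal_gen subsetD[OF ideal_gen_superset] imageI) (use * in auto)
  finally show "f \<in> E_ideal P" .
qed

text \<open>
  Multiplying by a polynomial only moves monomials up, so every monomial of an element lies above
  one of the generating monomials.
\<close>

lemma monomial_ideal_dvd:
  assumes "f \<in> ideal_gen (mono_xy ` N)" "coef_xy f (a, b) \<noteq> 0"
  shows "\<exists>i j. (i, j) \<in> N \<and> i \<le> a \<and> j \<le> b"
  using assms unfolding ideal_gen_def
proof (induction rule: ring_mod.span_induct_alt)
  case (step h s g)
  then obtain i j where s: "s = mono_xy (i, j)" "(i, j) \<in> N" by auto
  show ?case using step s
    by (auto simp: s(1) mult.commute[of h] coef_xy_mono_mult split: if_splits)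
qed auto

lemma coeff_form:
  assumes "f \<in> forms v"
  shows "coeff f b = (if b \<le> v then monom (coef_xy f (v - b, b)) (v - b) else 0)"
proof (rule poly_eqI)
  fix a
  have "coeff (coeff f b) a \<noteq> 0 \<Longrightarrow> a + b = v"
    using formsD[OF assms, of a b] by (simp add: coef_xy_def)
  thus "coeff (coeff f b) a = coeff (if b \<le> v then monom (coef_xy f (v - b, b)) (v - b) else 0) a"
    by (cases "a + b = v") (auto simp: coef_xy_def)
qed

lemma form_initial:
  assumes "f \<in> forms v" "f \<noteq> 0"
  shows "degree f \<le> v" "coef_xy f (v - degree f, degree f) \<noteq> 0"
    "initial_monomial f = mono_xy (v - degree f, degree f)"
proof -
  have lc: "lead_coeff f \<noteq> 0" using assms by simp
  have "lead_coeff f = (if degree f \<le> v then monom (coef_xy f (v - degree f, degree f)) (v - degree f) else 0)"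
    by (rule coeff_form[OF assms(1)])
  thus "degree f \<le> v" "coef_xy f (v - degree f, degree f) \<noteq> 0"
    "initial_monomial f = mono_xy (v - degree f, degree f)"
    using lc by (auto simp: initial_monomial_def degree_monom_eq split: if_splits)
qed

lemma coef_xy_above_degree: "degree f < b \<Longrightarrow> coef_xy f (a, b) = 0"
  by (simp add: coef_xy_def coeff_eq_0)

lemma degree_form_eqI:
  assumes "coef_xy f (a, b) \<noteq> 0" "\<And>a' b'. b < b' \<Longrightarrow> coef_xy f (a', b') = 0"
  shows "degree f = b"
proof (rule antisym)
  show "degree f \<le> b"
    by (rule degree_le) (use assms(2) in \<open>auto intro!: poly_eqI simp: coef_xy_def\<close>)
  show "b \<le> degree f" using assms(1) coef_xy_above_degree[of f b a] by force
qed

section \<open>Reduced elements of an ideal in the cell\<close>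

locale cell_ideal =
  fixes P :: "nat list" and I :: "'a::field poly poly set"
  assumes part: "is_partition P" and cell: "I \<in> jordan_cell P"
begin

lemma ideal: "is_ideal I" using cell by (simp add: jordan_cell_def graded_ideal_def)
lemmas zero = ideal_0[OF ideal] and add = ideal_add[OF ideal] and diff = ideal_diff[OF ideal]
  and mult = ideal_mult[OF ideal] and smult = ideal_smult[OF ideal] and sum = ideal_sum[OF ideal]

lemma hom: "f \<in> I \<Longrightarrow> hom_component i f \<in> I"
  using cell by (simp add: jordan_cell_def graded_ideal_def)

lemma initial_notin_C:
  assumes "f \<in> I" "f \<in> forms v" "f \<noteq> 0"
  shows "(v - degree f, degree f) \<notin> C_set P"
proof -
  have "initial_monomial f \<in> initial_ideal I"
    unfolding initial_ideal_def by (rule subsetD[OF ideal_gen_superset]) (use assms in blast)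
  hence "mono_xy (v - degree f, degree f) \<in> (E_ideal P :: 'a poly poly set)"
    using cell form_initial(3)[OF assms(2,3)] by (simp add: jordan_cell_def)
  thus ?thesis by (auto simp: E_ideal_iff[OF part])
qed

text \<open>
  The monomials of the diagram are independent modulo an ideal of the cell: a nonzero element has a
  nonzero homogeneous component, whose initial monomial lies outside the diagram.
\<close>

lemma eq_0I:
  assumes "f \<in> I" "\<And>\<nu>. \<nu> \<notin> C_set P \<Longrightarrow> coef_xy f \<nu> = 0"
  shows "f = 0"
proof -
  have "hom_component i f = 0" for i
  proof (rule ccontr)
    assume *: "hom_component i f \<noteq> 0"
    let ?g = "hom_component i f"
    have "coef_xy f (i - degree ?g, degree ?g) \<noteq> 0"
      using form_initial(2)[OF hom_component_forms *] by (auto simp: coef_hom_component split: if_splits)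
    thus False using assms(2) initial_notin_C[OF hom[OF assms(1)] hom_component_forms *] by blast
  qed
  thus ?thesis using hom_decomp[of f] by auto
qed

lemma eqI:
  assumes "f \<in> I" "g \<in> I" "\<And>\<nu>. \<nu> \<notin> C_set P \<Longrightarrow> coef_xy f \<nu> = coef_xy g \<nu>"
  shows "f = g"
  using eq_0I[OF diff[OF assms(1,2)]] assms(3) by auto

text \<open>
  A monomial of the initial ideal is a multiple of the initial monomial of some form, and the same
  multiple of that form has the required shape.
\<close>

lemma monic_form_exists:
  assumes "(a, b) \<notin> C_set P"
  shows "\<exists>f\<in>I. f \<in> forms (a + b) \<and> coef_xy f (a, b) = 1 \<and> (\<forall>a' b'. b < b' \<longrightarrow> coef_xy f (a', b') = 0)"
proof -
  let ?N = "{(v - degree f, degree f) | f v. f \<in> I \<and> f \<in> forms v \<and> f \<noteq> 0}"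
  have "mono_xy (a, b) \<in> initial_ideal I"
    using cell assms by (auto simp: jordan_cell_def E_ideal_iff[OF part])
  moreover have "{initial_monomial f | f i. f \<in> I \<and> f \<in> forms i \<and> f \<noteq> 0} \<subseteq> mono_xy ` ?N"
    using form_initial(3) by fast
  ultimately have "mono_xy (a, b) \<in> ideal_gen (mono_xy ` ?N :: 'a poly poly set)"
    unfolding initial_ideal_def ideal_gen_def using ring_mod.span_mono by blast
  from monomial_ideal_dvd[OF this, of a b] obtain f v where
    f: "f \<in> I" "f \<in> forms v" "f \<noteq> 0" and le: "v - degree f \<le> a" "degree f \<le> b" by auto
  let ?c = "coef_xy f (v - degree f, degree f)"
  let ?g = "scal (inverse ?c) (mono_xy (a - (v - degree f), b - degree f) * f)"
  have c: "?c \<noteq> 0" "degree f \<le> v" using form_initial[OF f(2,3)] by auto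
  have "?g \<in> I" by (intro smult mult f)
  moreover have "?g \<in> forms (a + b)"
    using forms_scal[OF forms_mono_mult[OF f(2), of "a - (v - degree f)" "b - degree f"]] le c
    by (simp)
  moreover have "coef_xy ?g (a, b) = 1" using c le by (simp add: coef_xy_mono_mult)
  moreover have "\<forall>a' b'. b < b' \<longrightarrow> coef_xy ?g (a', b') = 0"
    using le by (auto simp: coef_xy_mono_mult coef_xy_above_degree)
  ultimately show ?thesis by blast
qed

text \<open>
  Elimination of the monomials outside the diagram, from the highest power of y downwards.
\<close>

lemma reduced_exists:
  assumes "(a, b) \<notin> C_set P"
  shows "\<exists>f\<in>I. f \<in> forms (a + b) \<and>
     (\<forall>\<nu>. \<nu> \<notin> C_set P \<longrightarrow> coef_xy f \<nu> = (if \<nu> = (a, b) then 1 else 0))"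
  using assms
proof (induction b arbitrary: a rule: less_induct)
  case (less b)
  let ?v = "a + b" and ?B = "{b'. b' < b \<and> (a + b - b', b') \<notin> C_set P}"
  obtain f where f: "f \<in> I" "f \<in> forms ?v" "coef_xy f (a, b) = 1"
    "\<And>a' b'. b < b' \<Longrightarrow> coef_xy f (a', b') = 0"
    using monic_form_exists[OF less.prems] by blast
  have "\<forall>b'\<in>?B. \<exists>f\<in>I. f \<in> forms ?v \<and>
     (\<forall>\<nu>. \<nu> \<notin> C_set P \<longrightarrow> coef_xy f \<nu> = (if \<nu> = (?v - b', b') then 1 else 0))"
  proof
    fix b' assume "b' \<in> ?B"
    thus "\<exists>f\<in>I. f \<in> forms ?v \<and>
     (\<forall>\<nu>. \<nu> \<notin> C_set P \<longrightarrow> coef_xy f \<nu> = (if \<nu> = (?v - b', b') then 1 else 0))"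
      using less.IH[of b' "?v - b'"] by auto
  qed
  then obtain r where r: "\<And>b'. b' \<in> ?B \<Longrightarrow> r b' \<in> I" "\<And>b'. b' \<in> ?B \<Longrightarrow> r b' \<in> forms ?v"
    "\<And>b' \<nu>. b' \<in> ?B \<Longrightarrow> \<nu> \<notin> C_set P \<Longrightarrow> coef_xy (r b') \<nu> = (if \<nu> = (?v - b', b') then 1 else 0)"
    by (simp only: Bex_def bchoice_iff) blast
  let ?g = "f - (\<Sum>b'\<in>?B. scal (coef_xy f (?v - b', b')) (r b'))"
  have "?g \<in> I" by (intro diff f sum smult r)
  moreover have g: "?g \<in> forms ?v" by (intro forms_diff f forms_sum forms_scal r)
  moreover have "coef_xy ?g \<nu> = (if \<nu> = (a, b) then 1 else 0)" if \<nu>: "\<nu> \<notin> C_set P" for \<nu>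
  proof (cases "fst \<nu> + snd \<nu> = ?v")
    case False
    thus ?thesis using formsD[OF g, of "fst \<nu>" "snd \<nu>"] by auto
  next
    case True
    then obtain b'' where b'': "\<nu> = (?v - b'', b'')" "b'' \<le> ?v" by (metis add_diff_cancel_right' le_add2 prod.collapse)
    have "coef_xy ?g \<nu> = coef_xy f \<nu> - (\<Sum>b'\<in>?B. if b' = b'' then coef_xy f (?v - b', b') else 0)"
      unfolding coef_xy_simps coef_xy_sum using r(3) \<nu> b''
      by (intro arg_cong2[of _ _ _ _ "(-)"] refl sum.cong) auto
    also have "\<dots> = (if b'' < b then 0 else coef_xy f \<nu>)"
      using \<nu> b'' by (subst sum.delta) auto
    also have "\<dots> = (if \<nu> = (a, b) then 1 else 0)"
      using f(3,4) b'' by (cases b b'' rule: linorder_cases) auto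
    finally show ?thesis .
  qed
  ultimately show ?case by blast
qed

lemma reduced_elem:
  assumes "\<mu> \<notin> C_set P"
  shows reduced_in: "reduced_elem P I \<mu> \<in> I"
    and coef_reduced: "\<nu> \<notin> C_set P \<Longrightarrow> coef_xy (reduced_elem P I \<mu>) \<nu> = (if \<nu> = \<mu> then 1 else 0)"
    and reduced_forms: "reduced_elem P I \<mu> \<in> forms (fst \<mu> + snd \<mu>)"
proof -
  obtain f where f: "f \<in> I" "f \<in> forms (fst \<mu> + snd \<mu>)"
     "\<forall>\<nu>. \<nu> \<notin> C_set P \<longrightarrow> coef_xy f \<nu> = (if \<nu> = \<mu> then 1 else 0)"
    using reduced_exists[of "fst \<mu>" "snd \<mu>"] assms by auto
  have "reduced_elem P I \<mu> = f" unfolding reduced_elem_def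
    by (rule the_equality) (use f in \<open>auto intro!: eqI\<close>)
  thus "reduced_elem P I \<mu> \<in> I"
    "\<nu> \<notin> C_set P \<Longrightarrow> coef_xy (reduced_elem P I \<mu>) \<nu> = (if \<nu> = \<mu> then 1 else 0)"
    "reduced_elem P I \<mu> \<in> forms (fst \<mu> + snd \<mu>)"
    using f by (simp_all del: split_paired_All)
qed

lemma reduced_expansion:
  assumes "f \<in> I" "finite A" "A \<inter> C_set P = {}"
    "\<And>\<nu>. \<nu> \<notin> C_set P \<Longrightarrow> coef_xy f \<nu> \<noteq> 0 \<Longrightarrow> \<nu> \<in> A"
  shows "f = (\<Sum>\<nu>\<in>A. scal (coef_xy f \<nu>) (reduced_elem P I \<nu>))"
proof (rule eqI)
  show "(\<Sum>\<nu>\<in>A. scal (coef_xy f \<nu>) (reduced_elem P I \<nu>)) \<in> I"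
    using assms(3) by (intro sum smult reduced_in) auto
  fix \<nu> assume \<nu>: "\<nu> \<notin> C_set P"
  have "coef_xy (\<Sum>\<nu>\<in>A. scal (coef_xy f \<nu>) (reduced_elem P I \<nu>)) \<nu>
     = (\<Sum>\<mu>\<in>A. if \<mu> = \<nu> then coef_xy f \<mu> else 0)"
    unfolding coef_xy_sum
  proof (intro sum.cong refl)
    fix \<mu> assume "\<mu> \<in> A"
    hence "\<mu> \<notin> C_set P" using assms(3) by blast
    thus "coef_xy (scal (coef_xy f \<mu>) (reduced_elem P I \<mu>)) \<nu> = (if \<mu> = \<nu> then coef_xy f \<mu> else 0)"
      using coef_reduced[OF _ \<nu>, of \<mu>] by simp
  qed
  also have "\<dots> = coef_xy f \<nu>" using assms(2) assms(4)[OF \<nu>] by (subst sum.delta) auto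
  finally show "coef_xy f \<nu> = coef_xy (\<Sum>\<nu>\<in>A. scal (coef_xy f \<nu>) (reduced_elem P I \<nu>)) \<nu>" ..
qed fact

lemma degree_reduced:
  assumes "(a, b) \<notin> C_set P"
  shows "degree (reduced_elem P I (a, b)) = b"
proof -
  let ?r = "reduced_elem P I (a, b)"
  note r = reduced_elem[OF assms]
  have c: "coef_xy ?r (a, b) = 1" using r(2)[OF assms] by simp
  hence nz: "?r \<noteq> 0" by auto
  have f: "?r \<in> forms (a + b)" using r(3) by simp
  have "(a + b - degree ?r, degree ?r) = (a, b)"
    using r(2)[OF initial_notin_C[OF r(1) f nz]] form_initial(2)[OF f nz] by (auto split: if_splits)
  thus ?thesis by simp
qed

end

section \<open>A parametrization of the cell\<close>

text \<open>
  The degree condition says that the differences \<open>edeg P b + 1 - edeg P j\<close>, which appear as exponents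
  of x in \<open>recur_relation\<close>, are not negative wherever the coefficient is nonzero.
\<close>

definition admissible_coeffs :: "nat list \<Rightarrow> (nat \<Rightarrow> nat \<Rightarrow> 'a::field) \<Rightarrow> bool" where
  "admissible_coeffs P c \<longleftrightarrow> (\<forall>b j. c b j \<noteq> 0 \<longrightarrow> j \<le> b \<and> edeg P j \<le> edeg P b + 1)"

fun recur :: "(nat \<Rightarrow> nat \<Rightarrow> 'a::field) \<Rightarrow> nat \<Rightarrow> 'a poly poly" where
  "recur c 0 = 1"
| "recur c (Suc b) = mono_xy (0, 1) * recur c b +
     (\<Sum>j\<le>b. smult (monom (c b j) (Suc b - j)) (recur c j))"

definition recur_gen :: "nat list \<Rightarrow> (nat \<Rightarrow> nat \<Rightarrow> 'a::field) \<Rightarrow> nat \<Rightarrow> 'a poly poly" where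
  "recur_gen P c b = smult (monom 1 (row P b)) (recur c b)"

text \<open>
  As \<open>b\<close> varies, the elements \<open>recur_gen P c b\<close> form a basis over k[x] if the coefficients are admissible.
\<close>

definition recur_ideal :: "nat list \<Rightarrow> (nat \<Rightarrow> nat \<Rightarrow> 'a::field) \<Rightarrow> 'a poly poly set" where
  "recur_ideal P c = ideal_gen (range (recur_gen P c))"

lemma is_ideal_recur_ideal: "is_ideal (recur_ideal P c)"
  by (simp add: recur_ideal_def)

lemma recur_gen_in: "recur_gen P c b \<in> recur_ideal P c"
  by (auto simp: recur_ideal_def intro: subsetD[OF ideal_gen_superset])

lemma one_forms: "1 \<in> forms 0"
  using forms_mono[of 0 0 0] by (simp add: mono_xy_def monom_0 one_pCons[symmetric])

lemma recur_forms: "recur c b \<in> forms b"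
proof (induction b rule: less_induct)
  case (less b)
  show ?case
  proof (cases b)
    case 0 thus ?thesis by (simp add: one_forms)
  next
    case (Suc n)
    have "smult (monom (c n j) (Suc n - j)) (recur c j) \<in> forms (Suc n)" if "j \<le> n" for j
      using forms_smult_monom[OF less[of j], of "c n j" "Suc n - j"] that Suc by simp
    moreover have "mono_xy (0, 1) * recur c n \<in> forms (Suc n)"
      using forms_mono_mult[OF less[of n], of 0 1] Suc by simp
    ultimately show ?thesis using Suc by (auto intro!: forms_add forms_sum)
  qed
qed

lemma coef_recur_top [simp]: "coef_xy (recur c b) (0, b) = 1"
proof (induction b)
  case 0 show ?case by (simp add: coef_xy_def)
next
  case (Suc b) thus ?case
    by (simp add: coef_xy_mono_mult coef_xy_smult_monom)
qed

lemma recur_gen_forms: "recur_gen P c b \<in> forms (edeg P b)"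
  using forms_smult_monom[OF recur_forms, of 1 "row P b" c b] by (simp add: recur_gen_def edeg_def)

lemma degree_recur: "degree (recur c b) = b" and lead_coeff_recur: "coeff (recur c b) b = 1"
proof -
  show "degree (recur c b) = b"
    using formsD[OF recur_forms, of c b] by (intro degree_form_eqI[where a = 0]) fastforce+
  show "coeff (recur c b) b = 1"
    using coeff_form[OF recur_forms, of c b b] by (simp add: monom_0 one_pCons)
qed

text \<open>
  These are the syzygies of the generators: the recursion multiplied by the power of x that belongs
  to the row \<open>b\<close>, every term being again a multiple of a generator.
\<close>

lemma recur_relation:
  assumes "is_partition P" "admissible_coeffs P c"
  shows "mono_xy (0, 1) * recur_gen P c b =
    smult (monom 1 (row P b - row P (Suc b))) (recur_gen P c (Suc b)) -
    (\<Sum>j\<le>b. smult (monom (c b j) (edeg P b + 1 - edeg P j)) (recur_gen P c j))"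
proof -
  have le: "row P (Suc b) \<le> row P b" using row_antimono[OF assms(1)] by simp
  have "smult (monom 1 (row P b - row P (Suc b))) (recur_gen P c (Suc b)) =
        smult (monom 1 (row P b)) (recur c (Suc b))"
    using le by (simp add: recur_gen_def mult_monom del: recur.simps)
  also have "\<dots> = mono_xy (0, 1) * recur_gen P c b +
     (\<Sum>j\<le>b. smult (monom 1 (row P b)) (smult (monom (c b j) (Suc b - j)) (recur c j)))"
    by (simp add: recur_gen_def smult_add_right kx.scale_sum_right)
  also have "(\<Sum>j\<le>b. smult (monom 1 (row P b)) (smult (monom (c b j) (Suc b - j)) (recur c j))) =
    (\<Sum>j\<le>b. smult (monom (c b j) (edeg P b + 1 - edeg P j)) (recur_gen P c j))"
  proof (rule sum.cong)
    fix j assume "j \<in> {..b}"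
    hence j: "j \<le> b" by simp
    show "smult (monom 1 (row P b)) (smult (monom (c b j) (Suc b - j)) (recur c j)) =
        smult (monom (c b j) (edeg P b + 1 - edeg P j)) (recur_gen P c j)"
    proof (cases "c b j = 0")
      case False
      hence "edeg P j \<le> edeg P b + 1" using assms(2) by (auto simp: admissible_coeffs_def)
      thus ?thesis using j by (simp add: recur_gen_def mult_monom edeg_def)
    qed (simp add: recur_gen_def)
  qed simp
  finally show ?thesis by simp
qed

lemma recur_ideal_eq_span:
  assumes "is_partition P" "admissible_coeffs P c"
  shows "recur_ideal P c = kx.span (range (recur_gen P c))" (is "_ = ?S")
proof
  have y: "mono_xy (0, 1) * f \<in> ?S" if "f \<in> ?S" for f
    using that
  proof (induction rule: kx.span_induct_alt)
    case (step q s g)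
    then obtain b where s: "s = recur_gen P c b" by auto
    have "mono_xy (0, 1) * s \<in> ?S" unfolding s recur_relation[OF assms]
      by (intro kx.span_diff kx.span_sum kx.span_scale kx.span_base rangeI)
    thus ?case using step by (auto simp: algebra_simps intro!: kx.span_add kx.span_scale)
  qed (simp add: kx.span_zero)
  have m: "q * f \<in> ?S" if "f \<in> ?S" for q f
  proof (induction q)
    case (pCons a q)
    have "pCons a q * f = smult a f + mono_xy (0, 1) * (q * f)"
      by (simp add: mono_xy_def monom_0 monom_Suc one_pCons[symmetric] mult_pCons_left)
    moreover have "q * f \<in> ?S" by (rule pCons.IH)
    ultimately show ?case using that y by (metis kx.span_add kx.span_scale)
  qed (simp add: kx.span_zero)
  show "recur_ideal P c \<subseteq> ?S" unfolding recur_ideal_def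
    by (rule ideal_gen_least[OF is_idealI])
       (auto intro: kx.span_zero kx.span_add m kx.span_base)
  have "kx.subspace (recur_ideal P c)"
    unfolding kx.subspace_def recur_ideal_def
    using ideal_0[OF is_ideal_gen] ideal_add[OF is_ideal_gen] ideal_smult[OF is_ideal_gen] by blast
  thus "?S \<subseteq> recur_ideal P c"
    by (intro kx.span_minimal) (auto simp: recur_ideal_def intro: subsetD[OF ideal_gen_superset])
qed

text \<open>
  The generators have different degrees in y, so the highest one that occurs determines the leading
  coefficient.
\<close>

lemma recur_span_lead:
  assumes "f \<in> kx.span (recur_gen P c ` {..<n})" "f \<noteq> 0"
  shows "degree f < n \<and> monom 1 (row P (degree f)) dvd lead_coeff f"
  using assms
proof (induction n arbitrary: f)
  case (Suc n)
  from Suc.prems(1) obtain q where q: "f - smult q (recur_gen P c n) \<in> kx.span (recur_gen P c ` {..<n})"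
    by (auto simp: lessThan_Suc kx.span_insert)
  define g where "g = f - smult q (recur_gen P c n)"
  have g: "g = 0 \<or> degree g < n" using Suc.IH[OF q] by (auto simp: g_def)
  have f: "f = smult q (recur_gen P c n) + g" by (simp add: g_def)
  show ?case
  proof (cases "q = 0")
    case True
    thus ?thesis using Suc.IH[of f] Suc.prems q by auto
  next
    case False
    have gn: "coeff g n = 0" using g by (auto simp: coeff_eq_0)
    have cn: "coeff f n = q * monom 1 (row P n)"
      using lead_coeff_recur[of c n] gn by (simp add: f recur_gen_def)
    have "degree f \<le> n"
      unfolding f using g by (intro degree_add_le) (auto simp: recur_gen_def degree_recur)
    moreover have "n \<le> degree f" using False cn by (intro le_degree) simp
    ultimately show ?thesis using cn by auto
  qed
qed simp

lemma kx_span_range_finite: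
  assumes "f \<in> kx.span (range F)"
  shows "\<exists>n::nat. f \<in> kx.span (F ` {..<n})"
  using assms
proof (induction rule: kx.span_induct_alt)
  case base show ?case by (auto simp: kx.span_zero)
next
  case (step q s g)
  then obtain n b where n: "g \<in> kx.span (F ` {..<n})" "s = F b" by auto
  have "g \<in> kx.span (F ` {..<max n (Suc b)})"
    by (rule subsetD[OF kx.span_mono n(1)]) auto
  moreover have "s \<in> kx.span (F ` {..<max n (Suc b)})" by (rule kx.span_base) (auto simp: n)
  ultimately show ?case by (blast intro: kx.span_add kx.span_scale)
qed

text \<open>
  Leading coefficients confine the initial monomials to the complement of the diagram, and multiples of
  the generators by powers of x realize all of that complement.
\<close>

theorem recur_ideal_in_cell:
  assumes "is_partition P" "admissible_coeffs P c"
  shows "recur_ideal P c \<in> jordan_cell P"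
proof -
  let ?I = "recur_ideal P c"
  have ideal: "is_ideal ?I" by (simp add: recur_ideal_def)
  have graded: "graded_ideal ?I"
    unfolding graded_ideal_def
  proof (intro conjI ballI allI ideal)
    fix f i assume "f \<in> ?I"
    thus "hom_component i f \<in> ?I" unfolding recur_ideal_def
      by (rule ideal_gen_homogeneous[rotated]) (use recur_gen_forms in blast)
  qed
  have "initial_ideal ?I \<subseteq> E_ideal P"
    unfolding initial_ideal_def
  proof (rule ideal_gen_least)
    show "is_ideal (E_ideal P)" by (simp add: E_ideal_def)
    show "{initial_monomial f |f i. f \<in> ?I \<and> f \<in> forms i \<and> f \<noteq> 0} \<subseteq> E_ideal P"
    proof safe
      fix f :: "'a poly poly" and v assume f: "f \<in> ?I" "f \<in> forms v" "f \<noteq> 0"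
      obtain n where "f \<in> kx.span (recur_gen P c ` {..<n})"
        using f(1) kx_span_range_finite unfolding recur_ideal_eq_span[OF assms] by blast
      from recur_span_lead[OF this f(3)] obtain q where
        q: "lead_coeff f = monom 1 (row P (degree f)) * q" by (auto elim: dvdE)
      have "coeff (lead_coeff f) (v - degree f) \<noteq> 0"
        using form_initial(2)[OF f(2,3)] by (simp add: coef_xy_def)
      hence "row P (degree f) \<le> v - degree f"
        by (auto simp: q coeff_monom_mult split: if_splits)
      thus "initial_monomial f \<in> E_ideal P"
        using form_initial(3)[OF f(2,3)] by (auto simp: E_ideal_iff[OF assms(1)] C_set_iff)
    qed
  qed
  moreover have "E_ideal P \<subseteq> initial_ideal ?I"
    unfolding E_ideal_def
  proof (rule ideal_gen_least)
    show "is_ideal (initial_ideal ?I)" by (simp add: initial_ideal_def)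
    show "mono_xy ` (- C_set P) \<subseteq> initial_ideal ?I"
    proof safe
      fix a b assume "(a, b) \<notin> C_set P"
      hence ab: "row P b \<le> a" by (simp add: C_set_iff)
      let ?f = "smult (monom 1 (a - row P b)) (recur_gen P c b)"
      have eq: "?f = smult (monom 1 a) (recur c b)" using ab by (simp add: recur_gen_def mult_monom)
      have I: "?f \<in> ?I"
        by (intro ideal_smult is_ideal_recur_ideal recur_gen_in)
      have F: "?f \<in> forms (a + b)" unfolding eq by (intro forms_smult_monom recur_forms)
      have nz: "?f \<noteq> 0" "degree ?f = b"
        unfolding eq using degree_recur[of c b] lead_coeff_recur[of c b] by auto
      have "initial_monomial ?f = mono_xy (a, b)"
        using form_initial(3)[OF F nz(1)] nz(2) by simp
      thus "mono_xy (a, b) \<in> initial_ideal ?I"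
        unfolding initial_ideal_def
        by (intro subsetD[OF ideal_gen_superset]) (use I F nz in force)
    qed
  qed
  ultimately show ?thesis using graded by (auto simp: jordan_cell_def)
qed

context cell_ideal
begin

text \<open>
  Division by a family with one element for each power of y. By homogeneity the coefficient of each
  power of y is a monomial in x, and it is divisible by the leading coefficient of the corresponding
  member because initial monomials avoid the diagram.
\<close>

lemma row_expansion:
  assumes F: "\<And>j. F j \<in> I" "\<And>j. F j \<in> forms (edeg P j)" "\<And>j. coef_xy (F j) (row P j, j) = 1"
    "\<And>j. degree (F j) \<le> j"
  assumes "f \<in> I" "f \<in> forms v" "\<And>b'. n \<le> b' \<Longrightarrow> coeff f b' = 0"
  shows "\<exists>a. f = (\<Sum>j<n. smult (monom (a j) (v - edeg P j)) (F j)) \<and> (\<forall>j. a j \<noteq> 0 \<longrightarrow> j < n \<and> edeg P j \<le> v)"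
  using assms(5-7)
proof (induction n arbitrary: f)
  case 0
  hence "f = 0" by (intro poly_eqI) auto
  thus ?case by (intro exI[of _ "\<lambda>_. 0"]) auto
next
  case (Suc n)
  show ?case
  proof (cases "coeff f n = 0")
    case True
    have "coeff f b' = 0" if "n \<le> b'" for b' using Suc.prems(3)[of b'] True that by (cases "b' = n") auto
    from Suc.IH[OF Suc.prems(1,2) this] obtain a where
      a: "f = (\<Sum>j<n. smult (monom (a j) (v - edeg P j)) (F j))" "\<forall>j. a j \<noteq> 0 \<longrightarrow> j < n \<and> edeg P j \<le> v" by blast
    hence "a n = 0" by blast
    with a show ?thesis by (intro exI[of _ a]) auto
  next
    case False
    have dn: "degree f = n"
      by (rule antisym[OF degree_le le_degree]) (use Suc.prems(3) False in auto)
    have f0: "f \<noteq> 0" using False by auto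
    have "(v - n, n) \<notin> C_set P" "n \<le> v"
      using initial_notin_C[OF Suc.prems(1,2) f0] form_initial(1)[OF Suc.prems(2) f0] dn by auto
    hence v: "edeg P n \<le> v" by (auto simp: C_set_iff edeg_def)
    define s where "s = coef_xy f (v - n, n)"
    let ?h = "smult (monom s (v - edeg P n)) (F n)"
    have h: "?h \<in> I" "?h \<in> forms v"
      using smult[OF F(1)] forms_smult_monom[OF F(2)[of n], of s "v - edeg P n"] v by auto
    have cF: "coeff (F n) n = monom 1 (row P n)"
      using coeff_form[OF F(2)[of n], of n] F(3)[of n] by (simp add: edeg_def)
    have "coeff f n = monom s (v - n)"
      using coeff_form[OF Suc.prems(2), of n] \<open>n \<le> v\<close> by (simp add: s_def)
    hence n0: "coeff (f - ?h) n = 0"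
      using v by (simp add: cF mult_monom edeg_def)
    have "coeff (f - ?h) b' = 0" if "n \<le> b'" for b'
    proof (cases "b' = n")
      case False
      hence "coeff (F n) b' = 0" using F(4)[of n] that by (intro coeff_eq_0) auto
      thus ?thesis using Suc.prems(3)[of b'] False that by simp
    qed (use n0 in simp)
    from Suc.IH[OF diff[OF Suc.prems(1) h(1)] forms_diff[OF Suc.prems(2) h(2)] this] obtain a where
      a: "f - ?h = (\<Sum>j<n. smult (monom (a j) (v - edeg P j)) (F j))" "\<forall>j. a j \<noteq> 0 \<longrightarrow> j < n \<and> edeg P j \<le> v"
      by blast
    let ?a = "a(n := s)"
    have "(\<Sum>j<n. smult (monom (?a j) (v - edeg P j)) (F j)) = (\<Sum>j<n. smult (monom (a j) (v - edeg P j)) (F j))"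
      by (intro sum.cong) auto
    hence "f = (\<Sum>j<Suc n. smult (monom (?a j) (v - edeg P j)) (F j))"
      using a(1) by (simp add: algebra_simps)
    moreover have "\<forall>j. ?a j \<noteq> 0 \<longrightarrow> j < Suc n \<and> edeg P j \<le> v" using a(2) v by (auto simp: less_Suc_eq)
    ultimately show ?thesis by blast
  qed
qed

text \<open>
  The reduced elements at the ends of the rows satisfy syzygies of the form of \<open>recur_relation\<close>, with
  coefficients supplied by division. These syzygies determine the elements one after the other, and
  so they coincide with the generators built by the recursion.
\<close>

theorem is_recur_ideal: "\<exists>c. admissible_coeffs P c \<and> I = recur_ideal P c"
proof -
  define F where "F b = reduced_elem P I (row P b, b)" for b
  have nC: "(row P b, b) \<notin> C_set P" for b by (simp add: C_set_iff)
  have F: "F b \<in> I" "F b \<in> forms (edeg P b)" "coef_xy (F b) (row P b, b) = 1" "degree (F b) \<le> b" for b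
    using reduced_in[OF nC] reduced_forms[OF nC, of b] coef_reduced[OF nC nC, of b b] degree_reduced[OF nC, of b]
    by (auto simp: F_def edeg_def)
  have cF: "coeff (F b) b = monom 1 (row P b)" for b
    using coeff_form[OF F(2)[of b], of b] F(3)[of b] by (simp add: edeg_def)
  let ?y = "mono_xy (0, 1) :: 'a poly poly"
  have "\<exists>a. ?y * F b - smult (monom 1 (row P b - row P (Suc b))) (F (Suc b)) =
      (\<Sum>j<Suc b. smult (monom (a j) (edeg P b + 1 - edeg P j)) (F j)) \<and>
      (\<forall>j. a j \<noteq> 0 \<longrightarrow> j < Suc b \<and> edeg P j \<le> edeg P b + 1)" for b
  proof (rule row_expansion[OF F])
    let ?f = "?y * F b - smult (monom 1 (row P b - row P (Suc b))) (F (Suc b))"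
    have le: "row P (Suc b) \<le> row P b" using row_antimono[OF part] by simp
    show "?f \<in> I" by (intro diff mult smult F)
    have "?y * F b \<in> forms (edeg P b + 1)" using forms_mono_mult[OF F(2)[of b], of 0 1] by simp
    moreover have "smult (monom 1 (row P b - row P (Suc b))) (F (Suc b)) \<in> forms (edeg P b + 1)"
      using forms_smult_monom[OF F(2)[of "Suc b"], of 1 "row P b - row P (Suc b)"] le
      by (simp add: edeg_def)
    ultimately show "?f \<in> forms (edeg P b + 1)" by (rule forms_diff)
    have y: "?y * g = pCons 0 g" for g
      by (simp add: mono_xy_def monom_0 monom_Suc one_pCons[symmetric])
    fix b' assume b': "Suc b \<le> b'"
    show "coeff ?f b' = 0"
    proof (cases "b' = Suc b")
      case True
      thus ?thesis using le unfolding y by (simp add: cF mult_monom)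
    next
      case False
      hence "coeff (F b) (b' - 1) = 0" "coeff (F (Suc b)) b' = 0"
        using b' F(4)[of b] F(4)[of "Suc b"] by (auto intro!: coeff_eq_0)
      thus ?thesis using b' unfolding y by (auto simp: coeff_pCons split: nat.split)
    qed
  qed
  hence "\<forall>b. \<exists>a. ?y * F b - smult (monom 1 (row P b - row P (Suc b))) (F (Suc b)) =
      (\<Sum>j<Suc b. smult (monom (a j) (edeg P b + 1 - edeg P j)) (F j)) \<and>
      (\<forall>j. a j \<noteq> 0 \<longrightarrow> j < Suc b \<and> edeg P j \<le> edeg P b + 1)" by blast
  from choice[OF this] obtain a where a: "\<And>b. ?y * F b - smult (monom 1 (row P b - row P (Suc b))) (F (Suc b)) =
      (\<Sum>j<Suc b. smult (monom (a b j) (edeg P b + 1 - edeg P j)) (F j))"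
    "\<And>b j. a b j \<noteq> 0 \<Longrightarrow> j < Suc b \<and> edeg P j \<le> edeg P b + 1" by blast
  define c where "c b j = - a b j" for b j
  have c: "admissible_coeffs P c" using a(2) by (auto simp: admissible_coeffs_def c_def less_Suc_eq_le)
  have eq: "F b = recur_gen P c b" for b
  proof (induction b rule: less_induct)
    case (less b)
    show ?case
    proof (cases b)
      case 0
      have "F 0 = smult (monom 1 (row P 0)) 1"
      proof (rule poly_eqI)
        fix n show "coeff (F 0) n = coeff (smult (monom 1 (row P 0)) 1) n"
          using cF[of 0] F(4)[of 0] by (cases n) (auto simp: coeff_eq_0)
      qed
      thus ?thesis using 0 by (simp add: recur_gen_def)
    next
      case (Suc n)
      let ?m = "monom 1 (row P n - row P (Suc n)) :: 'a poly"
      have "smult ?m (F (Suc n)) = ?y * F n + (\<Sum>j\<le>n. smult (monom (c n j) (edeg P n + 1 - edeg P j)) (F j))"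
        using a(1)[of n] by (simp add: c_def minus_monom[symmetric] sum_negf lessThan_Suc_atMost algebra_simps)
      also have "\<dots> = ?y * recur_gen P c n + (\<Sum>j\<le>n. smult (monom (c n j) (edeg P n + 1 - edeg P j)) (recur_gen P c j))"
        using less Suc by (intro arg_cong2[of _ _ _ _ "(+)"] sum.cong) auto
      also have "\<dots> = smult ?m (recur_gen P c (Suc n))"
        unfolding recur_relation[OF part c] by simp
      finally have "smult ?m (F (Suc n) - recur_gen P c (Suc n)) = 0" by (simp add: smult_diff_right)
      thus ?thesis using Suc by (simp add: monom_eq_0_iff)
    qed
  qed
  have "I = recur_ideal P c"
  proof
    show "recur_ideal P c \<subseteq> I" unfolding recur_ideal_def
      by (rule ideal_gen_least[OF ideal]) (use F(1) eq in auto)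
    have form: "f \<in> recur_ideal P c" if f: "f \<in> I" "f \<in> forms v" for f v
    proof -
      have "coeff f b' = 0" if "Suc (degree f) \<le> b'" for b' using that by (intro coeff_eq_0) auto
      from row_expansion[OF F f this] obtain a where
        "f = (\<Sum>j<Suc (degree f). smult (monom (a j) (v - edeg P j)) (F j))" by blast
      also have "\<dots> \<in> recur_ideal P c" unfolding recur_ideal_def eq
        by (intro ideal_sum ideal_smult is_ideal_gen subsetD[OF ideal_gen_superset] rangeI)
      finally show ?thesis .
    qed
    show "I \<subseteq> recur_ideal P c"
    proof
      fix f assume f: "f \<in> I"
      obtain n where "f = (\<Sum>i\<le>n. hom_component i f)" using hom_decomp by blast
      also have "\<dots> \<in> recur_ideal P c"
        using form[OF hom[OF f] hom_component_forms]
        by (intro ideal_sum) (auto simp: recur_ideal_def)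
      finally show "f \<in> recur_ideal P c" .
    qed
  qed
  with c show ?thesis by blast
qed

end

section \<open>Irreducibility of the cell\<close>

definition polynomial_fun :: "('a::field \<Rightarrow> 'a) \<Rightarrow> bool" where
  "polynomial_fun f \<longleftrightarrow> (\<exists>q. \<forall>t. f t = poly q t)"

lemma polynomial_fun_const: "polynomial_fun (\<lambda>t. c)"
  unfolding polynomial_fun_def by (intro exI[of _ "[:c:]"]) simp
lemma polynomial_fun_id: "polynomial_fun (\<lambda>t. t)"
  unfolding polynomial_fun_def by (intro exI[of _ "[:0, 1:]"]) simp
lemma polynomial_fun_add: "polynomial_fun f \<Longrightarrow> polynomial_fun g \<Longrightarrow> polynomial_fun (\<lambda>t. f t + g t)"
  unfolding polynomial_fun_def by (metis poly_add)
lemma polynomial_fun_diff: "polynomial_fun f \<Longrightarrow> polynomial_fun g \<Longrightarrow> polynomial_fun (\<lambda>t. f t - g t)"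
  unfolding polynomial_fun_def by (metis poly_diff)
lemma polynomial_fun_mult: "polynomial_fun f \<Longrightarrow> polynomial_fun g \<Longrightarrow> polynomial_fun (\<lambda>t. f t * g t)"
  unfolding polynomial_fun_def by (metis poly_mult)
lemma polynomial_fun_sum:
  "(\<And>i. i \<in> A \<Longrightarrow> polynomial_fun (f i)) \<Longrightarrow> polynomial_fun (\<lambda>t. \<Sum>i\<in>A. f i t)"
  by (induction A rule: infinite_finite_induct) (auto intro: polynomial_fun_const polynomial_fun_add)

lemmas polynomial_fun_intros =
  polynomial_fun_const polynomial_fun_id polynomial_fun_add polynomial_fun_diff
  polynomial_fun_mult polynomial_fun_sum

lemma polynomial_fun_recur:
  assumes "\<And>b j. polynomial_fun (\<lambda>t. c t b j)"
  shows "polynomial_fun (\<lambda>t. coef_xy (recur (c t) b) \<nu>)"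
proof (induction b arbitrary: \<nu> rule: less_induct)
  case (less b)
  obtain a b' where \<nu>: "\<nu> = (a, b')" by (cases \<nu>)
  show ?case
  proof (cases b)
    case 0 thus ?thesis by (simp add: polynomial_fun_const)
  next
    case (Suc n)
    have 1: "polynomial_fun (\<lambda>t. coef_xy (mono_xy (0, 1) * recur (c t) n) \<nu>)"
      using less[of n "(a, b' - 1)"] Suc
      by (cases "1 \<le> b'") (auto simp: \<nu> coef_xy_mono_mult polynomial_fun_const)
    have 2: "polynomial_fun (\<lambda>t. coef_xy (smult (monom (c t n j) (Suc n - j)) (recur (c t) j)) \<nu>)"
      if "j \<le> n" for j
      using less[of j "(a - (Suc n - j), b')"] Suc that
      by (cases "Suc n - j \<le> a")
         (auto simp: \<nu> coef_xy_smult_monom polynomial_fun_const intro!: polynomial_fun_mult assms)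
    show ?thesis using 1 2 Suc by (auto intro!: polynomial_fun_add polynomial_fun_sum)
  qed
qed

text \<open>
  The element \<open>x\<^sup>a g\<^sub>b\<close> lies in the ideal and is monic at the exponent (a, b). Subtracting reduced
  elements of lower degree in y, with its own coefficients as factors, makes it reduced.
\<close>

lemma polynomial_fun_reduced:
  assumes P: "is_partition P" and c: "\<And>t. admissible_coeffs P (c t)"
    and pol: "\<And>b j. polynomial_fun (\<lambda>t. c t b j)"
    and "(a, b) \<notin> C_set P"
  shows "polynomial_fun (\<lambda>t. coef_xy (reduced_elem P (recur_ideal P (c t)) (a, b)) \<nu>)"
  using assms(4)
proof (induction b arbitrary: a rule: less_induct)
  case (less b)
  define B where "B = {b'. b' < b \<and> (a + b - b', b') \<notin> C_set P}"
  define f where "f t = smult (monom 1 a) (recur (c t) b)" for t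
  define r where "r t \<mu> = reduced_elem P (recur_ideal P (c t)) \<mu>" for t \<mu>
  have "f t = (\<Sum>b'\<in>insert b B. scal (coef_xy (f t) (a + b - b', b')) (r t (a + b - b', b')))" for t
  proof -
    interpret cell_ideal P "recur_ideal P (c t)"
      by standard (auto intro: P recur_ideal_in_cell c)
    let ?A = "(\<lambda>b'. (a + b - b', b')) ` insert b B"
    have row: "row P b \<le> a" using less.prems by (simp add: C_set_iff)
    have "f t = smult (monom 1 (a - row P b)) (recur_gen P (c t) b)"
      using row by (simp add: f_def recur_gen_def mult_monom)
    also have "\<dots> \<in> recur_ideal P (c t)"
      by (intro ideal_smult is_ideal_recur_ideal recur_gen_in)
    finally have fI: "f t \<in> recur_ideal P (c t)" .
    have form: "f t \<in> forms (a + b)" unfolding f_def by (intro forms_smult_monom recur_forms)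
    have "f t = (\<Sum>\<nu>\<in>?A. scal (coef_xy (f t) \<nu>) (r t \<nu>))" unfolding r_def
    proof (rule reduced_expansion[OF fI])
      show "finite ?A" by (simp add: B_def)
      show "?A \<inter> C_set P = {}" using less.prems by (auto simp: B_def)
      fix \<nu> assume \<nu>: "\<nu> \<notin> C_set P" "coef_xy (f t) \<nu> \<noteq> 0"
      obtain a' b' where [simp]: "\<nu> = (a', b')" by (cases \<nu>)
      have "a' + b' = a + b" using formsD[OF form] \<nu> by simp
      moreover have "b' \<le> b"
        using \<nu>(2) coef_xy_above_degree[of "f t" b b'] degree_recur[of "c t" b]
        by (metis \<open>\<nu> = (a', b')\<close> coef_xy_above_degree degree_smult_le f_def le_trans not_le_imp_less)
      ultimately have "a' = a + b - b'" "b' \<le> b" by auto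
      thus "\<nu> \<in> ?A" using \<nu> by (cases "b' = b") (auto simp: B_def)
    qed
    also have "\<dots> = (\<Sum>b'\<in>insert b B. scal (coef_xy (f t) (a + b - b', b')) (r t (a + b - b', b')))"
      by (subst sum.reindex) (auto simp: inj_on_def)
    finally show ?thesis .
  qed
  moreover have "coef_xy (f t) (a, b) = 1" for t by (simp add: f_def coef_xy_smult_monom)
  moreover have "finite B" "b \<notin> B" by (auto simp: B_def)
  ultimately have eq: "f t = r t (a, b) + (\<Sum>b'\<in>B. scal (coef_xy (f t) (a + b - b', b')) (r t (a + b - b', b')))" for t
    by (metis (no_types, lifting) add_diff_cancel_right' kvs.scale_one sum.insert)
  have "coef_xy (r t (a, b)) \<nu> = coef_xy (f t) \<nu> -
      (\<Sum>b'\<in>B. coef_xy (f t) (a + b - b', b') * coef_xy (r t (a + b - b', b')) \<nu>)" for t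
    using arg_cong[OF eq[of t], of "\<lambda>f. coef_xy f \<nu>"] by simp
  moreover have pf: "polynomial_fun (\<lambda>t. coef_xy (f t) \<nu>)" for \<nu>
    using polynomial_fun_recur[of c b, OF pol, of "(fst \<nu> - a, snd \<nu>)"]
    by (cases \<nu>; cases "a \<le> fst \<nu>") (auto simp: f_def coef_xy_smult_monom polynomial_fun_const)
  moreover have "polynomial_fun (\<lambda>t. coef_xy (r t (a + b - b', b')) \<nu>)" if "b' \<in> B" for b'
    using less.IH[of b' "a + b - b'"] that by (auto simp: B_def r_def)
  ultimately have "polynomial_fun (\<lambda>t. coef_xy (r t (a, b)) \<nu>)"
    by (simp del: split_paired_All) (intro polynomial_fun_diff polynomial_fun_sum polynomial_fun_mult, auto)
  thus ?case by (simp add: r_def)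
qed

text \<open>
  The two ideals are joined by the line through their recursion coefficients. Two regular functions
  restrict to nonzero polynomials on this line, whose product has a point where it does not vanish.
\<close>

theorem cell_irreducible:
  fixes I J :: "'a::field poly poly set"
  assumes inf: "infinite (UNIV :: 'a set)" and P: "is_partition P"
    and I: "I \<in> jordan_cell P" and J: "J \<in> jordan_cell P"
    and \<phi>: "\<phi> \<in> regular_funs P" "\<phi> I \<noteq> 0" and \<psi>: "\<psi> \<in> regular_funs P" "\<psi> J \<noteq> 0"
  shows "\<exists>K\<in>jordan_cell P. \<phi> K \<noteq> 0 \<and> \<psi> K \<noteq> 0"
proof -
  obtain c0 c1 where c0: "admissible_coeffs P c0" "I = recur_ideal P c0"
    and c1: "admissible_coeffs P c1" "J = recur_ideal P c1"
    using cell_ideal.is_recur_ideal[OF cell_ideal.intro[OF P I]]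
          cell_ideal.is_recur_ideal[OF cell_ideal.intro[OF P J]] by blast
  \<comment> \<open>admissibility is a linear condition\<close>
  define c where "c t b j = (1 - t) * c0 b j + t * c1 b j" for t b j
  have c: "admissible_coeffs P (c t)" for t
    using c0(1) c1(1) unfolding admissible_coeffs_def c_def by (metis add_0 mult_zero_right)
  have pol: "polynomial_fun (\<lambda>t. c t b j)" for b j
    unfolding c_def by (intro polynomial_fun_intros)
  have reg: "polynomial_fun (\<lambda>t. \<theta> (recur_ideal P (c t)))" if "\<theta> \<in> regular_funs P" for \<theta>
    using that
  proof induction
    case (coord \<mu> \<nu>)
    thus ?case using polynomial_fun_reduced[OF P c pol, of "fst \<mu>" "snd \<mu>"] by simp
  qed (auto intro: polynomial_fun_intros)
  obtain q0 q1 where q: "\<And>t. \<phi> (recur_ideal P (c t)) = poly q0 t" "\<And>t. \<psi> (recur_ideal P (c t)) = poly q1 t"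
    using reg[OF \<phi>(1)] reg[OF \<psi>(1)] unfolding polynomial_fun_def by blast
  have "c 0 = c0" "c 1 = c1" by (auto simp: c_def fun_eq_iff)
  hence "poly q0 0 \<noteq> 0" "poly q1 1 \<noteq> 0" using q(1)[of 0] q(2)[of 1] \<phi> \<psi> c0 c1 by auto
  hence "q0 * q1 \<noteq> 0" by auto
  hence "finite {t. poly (q0 * q1) t = 0}" by (rule poly_roots_finite)
  then obtain t where "poly (q0 * q1) t \<noteq> 0" using inf by (metis (mono_tags) finite_subset mem_Collect_eq subsetI)
  thus ?thesis using q recur_ideal_in_cell[OF P c, of t] by (intro bexI[of _ "recur_ideal P (c t)"]) auto
qed

section \<open>The minimal number of generators\<close>

lemma ideal_from_forms:
  assumes "graded_ideal I" "is_ideal J" "\<And>f v. f \<in> I \<Longrightarrow> f \<in> forms v \<Longrightarrow> f \<in> J"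
  shows "I \<subseteq> J"
proof
  fix f assume f: "f \<in> I"
  obtain n where n: "f = (\<Sum>i\<le>n. hom_component i f)" using hom_decomp by blast
  have "hom_component i f \<in> J" for i
    using assms(1) f by (intro assms(3)[of _ i]) (auto simp: graded_ideal_def)
  hence "(\<Sum>i\<le>n. hom_component i f) \<in> J" by (intro ideal_sum assms(2))
  thus "f \<in> J" using n by simp
qed

text \<open>
  The exponents at which the rows of the diagram end, including the first empty row.
\<close>

definition corners :: "nat list \<Rightarrow> expo set" where
  "corners P = (\<lambda>b. (row P b, b)) ` {..length P}"

lemma finite_corners: "finite (corners P)" by (simp add: corners_def)
lemma corners_notin_C: "\<mu> \<in> corners P \<Longrightarrow> \<mu> \<notin> C_set P"
  by (auto simp: corners_def C_set_iff)

text \<open>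
  The product of \<open>I\<close> with the maximal ideal (x, y).
\<close>

definition max_mult :: "'a::field poly poly set \<Rightarrow> 'a poly poly set" where
  "max_mult I = {mono_xy (1, 0) * f + mono_xy (0, 1) * g | f g. f \<in> I \<and> g \<in> I}"

lemma const_decomp:
  "\<exists>h1 h2. h = scal (coef_xy h (0, 0)) 1 + mono_xy (1, 0) * h1 + mono_xy (0, 1) * h2"
proof -
  obtain p h2 where h: "h = pCons p h2" by (cases h)
  obtain c p' where p: "p = pCons c p'" by (cases p)
  have "h = scal c 1 + mono_xy (1, 0) * [:p':] + mono_xy (0, 1) * h2"
    by (simp add: h p mono_xy_def monom_0 monom_Suc one_pCons[symmetric])
  moreover have "coef_xy h (0, 0) = c" by (simp add: coef_xy_def h p)
  ultimately show ?thesis by (intro exI[of _ "[:p':]"] exI[of _ h2]) simp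
qed

lemma linear_dependence:
  fixes \<alpha> :: "'u \<Rightarrow> 's \<Rightarrow> 'a::field"
  assumes "finite S" "finite U" "card S < card U"
  shows "\<exists>l. (\<exists>u\<in>U. l u \<noteq> 0) \<and> (\<forall>s\<in>S. (\<Sum>u\<in>U. l u * \<alpha> u s) = 0)"
  using assms
proof (induction S arbitrary: U \<alpha> rule: finite_induct)
  case empty
  then obtain u where "u \<in> U" by fastforce
  thus ?case by (intro exI[of _ "\<lambda>_. 1"]) auto
next
  case (insert s S)
  show ?case
  proof (cases "\<forall>u\<in>U. \<alpha> u s = 0")
    case True
    obtain l where "\<exists>u\<in>U. l u \<noteq> 0" "\<forall>s\<in>S. (\<Sum>u\<in>U. l u * \<alpha> u s) = 0"
      using insert.IH[of U \<alpha>] insert.prems insert.hyps by auto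
    thus ?thesis using True by (intro exI[of _ l]) auto
  next
    case False
    then obtain w where w: "w \<in> U" "\<alpha> w s \<noteq> 0" by blast
    define V where "V = U - {w}"
    have V: "finite V" "w \<notin> V" "U = insert w V" "card S < card V"
      using w insert.prems insert.hyps by (auto simp: V_def)
    obtain l where l: "\<exists>u\<in>V. l u \<noteq> 0"
      "\<And>t. t \<in> S \<Longrightarrow> (\<Sum>u\<in>V. l u * (\<alpha> u t - \<alpha> u s / \<alpha> w s * \<alpha> w t)) = 0"
      using insert.IH[OF V(1,4), of "\<lambda>u t. \<alpha> u t - \<alpha> u s / \<alpha> w s * \<alpha> w t"] by blast
    \<comment> \<open>the value at \<open>w\<close> makes the relation hold at \<open>s\<close>\<close>
    define l' where "l' = l(w := - (\<Sum>u\<in>V. l u * \<alpha> u s) / \<alpha> w s)"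
    have sum: "(\<Sum>u\<in>U. l' u * \<alpha> u t) = (\<Sum>u\<in>V. l u * \<alpha> u t) - (\<Sum>u\<in>V. l u * \<alpha> u s) / \<alpha> w s * \<alpha> w t" for t
    proof -
      have "(\<Sum>u\<in>V. l' u * \<alpha> u t) = (\<Sum>u\<in>V. l u * \<alpha> u t)"
        using V by (intro sum.cong) (auto simp: l'_def)
      thus ?thesis using V by (simp add: l'_def)
    qed
    have "(\<Sum>u\<in>U. l' u * \<alpha> u t) = 0" if "t \<in> S" for t
    proof -
      have "(\<Sum>u\<in>V. l u * (\<alpha> u t - \<alpha> u s / \<alpha> w s * \<alpha> w t)) =
          (\<Sum>u\<in>V. l u * \<alpha> u t - (l u * \<alpha> u s) * (\<alpha> w t / \<alpha> w s))"
        by (intro sum.cong refl) (simp only: right_diff_distrib divide_inverse mult_ac)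
      also have "\<dots> = (\<Sum>u\<in>V. l u * \<alpha> u t) - (\<Sum>u\<in>V. l u * \<alpha> u s) * (\<alpha> w t / \<alpha> w s)"
        by (simp only: sum_subtractf sum_distrib_right)
      finally show ?thesis using l(2)[OF that] unfolding sum by simp
    qed
    moreover have "(\<Sum>u\<in>U. l' u * \<alpha> u s) = 0" using w by (simp add: sum)
    moreover have "\<exists>u\<in>U. l' u \<noteq> 0" using l(1) V by (auto simp: l'_def)
    ultimately show ?thesis by (intro exI[of _ l']) auto
  qed
qed

lemma min_gens_le: "finite S \<Longrightarrow> ideal_gen S = I \<Longrightarrow> min_gens I \<le> card S"
  unfolding min_gens_def by (rule Least_le) blast

context cell_ideal
begin

lemma graded: "graded_ideal I" using cell by (simp add: jordan_cell_def)

text \<open>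
  The division lemma needs one element for every power of y. Beyond the last row these are the
  multiples by powers of y of the element with initial monomial \<open>y\<^sup>m\<close>.
\<close>

lemma generated_by_corners: "ideal_gen (reduced_elem P I ` corners P) = I"
proof
  show "ideal_gen (reduced_elem P I ` corners P) \<subseteq> I"
    using corners_notin_C reduced_in by (intro ideal_gen_least ideal) blast
  let ?m = "length P" and ?r = "reduced_elem P I" and ?J = "ideal_gen (reduced_elem P I ` corners P)"
  define F where "F j = (if j \<le> ?m then ?r (row P j, j) else mono_xy (0, j - ?m) * ?r (0, ?m))" for j
  have rowm: "row P j = 0" if "?m \<le> j" for j using that by (simp add: nth_default_def)
  have nC: "(row P j, j) \<notin> C_set P" for j by (simp add: C_set_iff)
  have nCm: "(0, ?m) \<notin> C_set P" using nC[of ?m] by (simp add: rowm)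
  have FJ: "F j \<in> ?J" for j
  proof -
    have "?r (row P j, j) \<in> ?J" if "j \<le> ?m" for j
      using that by (intro subsetD[OF ideal_gen_superset] imageI) (auto simp: corners_def)
    from this this[of ?m] show ?thesis by (auto simp: F_def rowm intro!: ideal_mult)
  qed
  have F: "F j \<in> I" "F j \<in> forms (edeg P j)" "coef_xy (F j) (row P j, j) = 1" "degree (F j) \<le> j" for j
  proof -
    show "F j \<in> I" using reduced_in[OF nC] reduced_in[OF nCm] by (auto simp: F_def intro!: mult)
    show form: "F j \<in> forms (edeg P j)"
      using reduced_forms[OF nC, of j] forms_mono_mult[OF reduced_forms[OF nCm], of 0 "j - ?m"]
      by (auto simp: F_def edeg_def rowm)
    show "coef_xy (F j) (row P j, j) = 1"
      using coef_reduced[OF nC nC, of j j] coef_reduced[OF nCm nCm]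
      by (auto simp: F_def coef_xy_mono_mult rowm)
    show "degree (F j) \<le> j"
    proof (cases "j \<le> ?m")
      case True thus ?thesis using degree_reduced[OF nC, of j] by (simp add: F_def)
    next
      case False
      hence "F j = 0 \<or> degree (F j) \<le> edeg P j" using form_initial(1)[OF form] by blast
      thus ?thesis using False by (auto simp: edeg_def rowm)
    qed
  qed
  show "I \<subseteq> ?J"
  proof (rule ideal_from_forms[OF graded])
    fix f v assume f: "f \<in> I" "f \<in> forms v"
    have "coeff f b' = 0" if "Suc (degree f) \<le> b'" for b' using that by (intro coeff_eq_0) auto
    from row_expansion[OF F f this] obtain a where
      eq: "f = (\<Sum>j<Suc (degree f). smult (monom (a j) (v - edeg P j)) (F j))" by blast
    show "f \<in> ?J" by (subst eq) (intro ideal_sum ideal_smult is_ideal_gen FJ)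
  qed simp
qed

lemma min_gens_witness: "\<exists>S. finite S \<and> card S = min_gens I \<and> ideal_gen S = I"
  unfolding min_gens_def
  by (rule LeastI_ex) (use finite_corners generated_by_corners in blast)

lemma max_mult_I: "f \<in> I \<Longrightarrow> g \<in> I \<Longrightarrow> mono_xy (1, 0) * f + mono_xy (0, 1) * g \<in> max_mult I"
  by (auto simp: max_mult_def)

lemma max_mult_0: "0 \<in> max_mult I"
  using max_mult_I[OF zero zero] by simp

lemma max_mult_add: "p \<in> max_mult I \<Longrightarrow> q \<in> max_mult I \<Longrightarrow> p + q \<in> max_mult I"
proof -
  assume "p \<in> max_mult I" "q \<in> max_mult I"
  then obtain f g f' g' where "p = mono_xy (1, 0) * f + mono_xy (0, 1) * g"
    "q = mono_xy (1, 0) * f' + mono_xy (0, 1) * g'" "f \<in> I" "g \<in> I" "f' \<in> I" "g' \<in> I"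
    by (auto simp: max_mult_def)
  thus ?thesis using max_mult_I[of "f + f'" "g + g'"] add by (simp add: algebra_simps)
qed

lemma max_mult_scal: "p \<in> max_mult I \<Longrightarrow> scal c p \<in> max_mult I"
proof -
  assume "p \<in> max_mult I"
  then obtain f g where "p = mono_xy (1, 0) * f + mono_xy (0, 1) * g" "f \<in> I" "g \<in> I"
    by (auto simp: max_mult_def)
  thus ?thesis using max_mult_I[of "scal c f" "scal c g"] smult by (simp add: smult_add_right)
qed

lemma max_mult_sum: "(\<And>i. i \<in> A \<Longrightarrow> f i \<in> max_mult I) \<Longrightarrow> sum f A \<in> max_mult I"
  by (induction A rule: infinite_finite_induct) (auto intro: max_mult_0 max_mult_add)

lemma hom_component_x: "hom_component v (mono_xy (1, 0) * f) =
    (if 1 \<le> v then mono_xy (1, 0) * hom_component (v - 1) f else 0)"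
  and hom_component_y: "hom_component v (mono_xy (0, 1) * f) =
    (if 1 \<le> v then mono_xy (0, 1) * hom_component (v - 1) f else 0)"
  for f :: "'a poly poly"
  using hom_component_mult[OF forms_mono[of 1 0 1], of v f]
        hom_component_mult[OF forms_mono[of 0 1 1], of v f] by (auto simp: mult.commute)

lemma max_mult_hom:
  assumes "p \<in> max_mult I"
  shows "\<exists>f\<in>I. \<exists>g\<in>I. hom_component v p = mono_xy (1, 0) * f + mono_xy (0, 1) * g \<and>
     (f \<in> forms (v - 1) \<and> g \<in> forms (v - 1)) \<and> (v = 0 \<longrightarrow> f = 0 \<and> g = 0)"
proof -
  obtain f g where fg: "p = mono_xy (1, 0) * f + mono_xy (0, 1) * g" "f \<in> I" "g \<in> I"
    using assms by (auto simp: max_mult_def)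
  show ?thesis
  proof (cases "v = 0")
    case True thus ?thesis using zero
      by (intro bexI[of _ 0]) (auto simp: fg hom_component_add hom_component_x[unfolded One_nat_def] hom_component_y[unfolded One_nat_def])
  next
    case False
    thus ?thesis using hom[OF fg(2)] hom[OF fg(3)]
      by (intro bexI[of _ "hom_component (v - 1) f"] bexI[of _ "hom_component (v - 1) g"])
         (auto simp: fg hom_component_add hom_component_x[unfolded One_nat_def] hom_component_y[unfolded One_nat_def])
  qed
qed

text \<open>
  A lower bound by the dimension of \<open>I\<close> modulo (x, y)I: any generating set spans this quotient over
  k, hence has at least as many members as an independent family. The generating set need not be
  homogeneous.
\<close>

lemma min_gens_ge:
  assumes U: "finite U" "U \<inter> C_set P = {}"
    and indep: "\<And>a. (\<Sum>\<mu>\<in>U. scal (a \<mu>) (reduced_elem P I \<mu>)) \<in> max_mult I \<Longrightarrow> \<forall>\<mu>\<in>U. a \<mu> = 0"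
  shows "card U \<le> min_gens I"
proof (rule ccontr)
  let ?r = "reduced_elem P I"
  obtain S where S: "finite S" "card S = min_gens I" "ideal_gen S = I"
    using min_gens_witness by blast
  have SI: "s \<in> I" if "s \<in> S" for s using that S(3) ideal_gen_superset by blast
  assume "\<not> card U \<le> min_gens I"
  hence less: "card S < card U" using S by simp
  have "\<exists>\<alpha>. ?r \<mu> - (\<Sum>s\<in>S. scal (\<alpha> s) s) \<in> max_mult I" if "\<mu> \<in> U" for \<mu>
  proof -
    have "?r \<mu> \<in> ideal_gen ((\<lambda>s. s) ` S)" using reduced_in[of \<mu>] that U S by auto
    from ideal_gen_finite[OF S(1) this] obtain h where h: "?r \<mu> = (\<Sum>s\<in>S. h s * s)" .
    have "h s * s - scal (coef_xy (h s) (0, 0)) s \<in> max_mult I" if "s \<in> S" for s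
    proof -
      obtain h1 h2 where
        d: "h s = scal (coef_xy (h s) (0, 0)) 1 + mono_xy (1, 0) * h1 + mono_xy (0, 1) * h2"
        using const_decomp by blast
      have "h s * s - scal (coef_xy (h s) (0, 0)) s = mono_xy (1, 0) * (h1 * s) + mono_xy (0, 1) * (h2 * s)"
        by (subst (1) d) (simp only: distrib_right mult_smult_left mult_1_left mult.assoc add_diff_cancel_left' add.assoc)
      thus ?thesis using max_mult_I[OF mult mult, OF SI[OF that] SI[OF that]] by simp
    qed
    hence "(\<Sum>s\<in>S. h s * s - scal (coef_xy (h s) (0, 0)) s) \<in> max_mult I"
      by (rule max_mult_sum)
    thus ?thesis unfolding h sum_subtractf[symmetric] by (intro exI[of _ "\<lambda>s. coef_xy (h s) (0, 0)"])
  qed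
  hence "\<forall>\<mu>\<in>U. \<exists>\<alpha>. ?r \<mu> - (\<Sum>s\<in>S. scal (\<alpha> s) s) \<in> max_mult I" by blast
  from bchoice[OF this] obtain \<alpha> where
    \<alpha>: "\<And>\<mu>. \<mu> \<in> U \<Longrightarrow> ?r \<mu> - (\<Sum>s\<in>S. scal (\<alpha> \<mu> s) s) \<in> max_mult I" by blast
  obtain l where l: "\<exists>u\<in>U. l u \<noteq> 0" "\<And>s. s \<in> S \<Longrightarrow> (\<Sum>u\<in>U. l u * \<alpha> u s) = 0"
    using linear_dependence[OF S(1) U(1) less] by blast
  have "(\<Sum>\<mu>\<in>U. scal (l \<mu>) (?r \<mu> - (\<Sum>s\<in>S. scal (\<alpha> \<mu> s) s))) \<in> max_mult I"
    by (intro max_mult_sum max_mult_scal \<alpha>)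
  also have "(\<Sum>\<mu>\<in>U. scal (l \<mu>) (?r \<mu> - (\<Sum>s\<in>S. scal (\<alpha> \<mu> s) s))) =
     (\<Sum>\<mu>\<in>U. scal (l \<mu>) (?r \<mu>)) - (\<Sum>\<mu>\<in>U. \<Sum>s\<in>S. scal (l \<mu> * \<alpha> \<mu> s) s)"
    by (simp add: smult_diff_right sum_subtractf kvs.scale_sum_right mult.commute)
  also have "(\<Sum>\<mu>\<in>U. \<Sum>s\<in>S. scal (l \<mu> * \<alpha> \<mu> s) s) = (\<Sum>s\<in>S. scal (\<Sum>\<mu>\<in>U. l \<mu> * \<alpha> \<mu> s) s)"
    by (subst sum.swap) (simp add: kvs.scale_sum_left)
  also have "\<dots> = 0" using l(2) by simp
  finally show False using indep[of l] l(1) by simp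
qed

text \<open>
  Graded Nakayama. A minimal generating set of reduced elements is independent modulo (x, y)I,
  because in a nontrivial relation one of them would be expressed by the others and by elements of
  lower degree. So its size is bounded by the number of generators of any generating set.
\<close>

lemma minimal_corner_generators:
  "\<exists>M\<subseteq>corners P. ideal_gen (reduced_elem P I ` M) = I \<and> card M \<le> min_gens I"
proof -
  let ?r = "reduced_elem P I"
  let ?Q = "\<lambda>M. M \<subseteq> corners P \<and> ideal_gen (?r ` M) = I"
  obtain M where M: "?Q M" and least: "\<And>M'. ?Q M' \<Longrightarrow> card M \<le> card M'"
    using ex_has_least_nat[of ?Q "corners P" card] generated_by_corners by blast
  have fin: "finite M" using M finite_corners finite_subset by blast
  have MC: "\<mu> \<notin> C_set P" if "\<mu> \<in> M" for \<mu> using that M corners_notin_C by blast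
  have rf: "?r \<mu> \<in> forms (fst \<mu> + snd \<mu>)" if "\<mu> \<in> M" for \<mu> using reduced_forms MC that by blast
  have "card M \<le> min_gens I"
  proof (rule min_gens_ge[OF fin])
    show "M \<inter> C_set P = {}" using MC by blast
    fix a assume a: "(\<Sum>\<mu>\<in>M. scal (a \<mu>) (?r \<mu>)) \<in> max_mult I"
    show "\<forall>\<mu>\<in>M. a \<mu> = 0"
    proof (rule ccontr)
      assume "\<not> ?thesis"
      then obtain \<mu>0 where \<mu>0: "\<mu>0 \<in> M" "a \<mu>0 \<noteq> 0" by blast
      define v where "v = fst \<mu>0 + snd \<mu>0"
      define N where "N = ideal_gen (?r ` (M - {\<mu>0}))"
      have N: "is_ideal N" by (simp add: N_def)
      have rN: "?r \<mu> \<in> N" if "\<mu> \<in> M" "\<mu> \<noteq> \<mu>0" for \<mu>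
        unfolding N_def by (rule subsetD[OF ideal_gen_superset]) (use that in auto)
      have low: "f \<in> N" if f: "f \<in> I" "f \<in> forms w" "w < v" for f w
      proof -
        obtain h where h: "f = (\<Sum>\<mu>\<in>M. h \<mu> * ?r \<mu>)"
          using ideal_gen_finite[OF fin] f(1) M by metis
        have "f = hom_component w f" using hom_component_form[OF f(2)] by simp
        also have "\<dots> = (\<Sum>\<mu>\<in>M. hom_component w (h \<mu> * ?r \<mu>))" by (subst h) (rule hom_component_sum)
        also have "\<dots> \<in> N"
        proof (rule ideal_sum[OF N])
          fix \<mu> assume \<mu>: "\<mu> \<in> M"
          show "hom_component w (h \<mu> * ?r \<mu>) \<in> N"
            using hom_component_mult[OF rf[OF \<mu>], of w "h \<mu>"] rN[OF \<mu>] f(3)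
            by (cases "\<mu> = \<mu>0") (auto simp: v_def intro: ideal_0[OF N] ideal_mult[OF N])
        qed
        finally show ?thesis .
      qed
      have "hom_component v (\<Sum>\<mu>\<in>M. scal (a \<mu>) (?r \<mu>)) \<in> N"
      proof -
        obtain f g where fg: "f \<in> I" "g \<in> I"
          "hom_component v (\<Sum>\<mu>\<in>M. scal (a \<mu>) (?r \<mu>)) = mono_xy (1, 0) * f + mono_xy (0, 1) * g"
          "f \<in> forms (v - 1)" "g \<in> forms (v - 1)" "v = 0 \<longrightarrow> f = 0 \<and> g = 0"
          using max_mult_hom[OF a] by blast
        have "f \<in> N" "g \<in> N"
          using low[OF fg(1,4)] low[OF fg(2,5)] fg(6) ideal_0[OF N] by (cases "v = 0"; simp)+
        thus ?thesis unfolding fg(3) by (intro ideal_add ideal_mult N)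
      qed
      also have "hom_component v (\<Sum>\<mu>\<in>M. scal (a \<mu>) (?r \<mu>)) =
         scal (a \<mu>0) (?r \<mu>0) + (\<Sum>\<mu>\<in>M - {\<mu>0}. hom_component v (scal (a \<mu>) (?r \<mu>)))"
        unfolding hom_component_sum
        using hom_component_form[OF rf[OF \<mu>0(1)], of v] fin \<mu>0
        by (subst sum.remove[of _ \<mu>0]) (auto simp: hom_component_scal v_def)
      finally have *: "scal (a \<mu>0) (?r \<mu>0) + (\<Sum>\<mu>\<in>M - {\<mu>0}. hom_component v (scal (a \<mu>) (?r \<mu>))) \<in> N" .
      have "(\<Sum>\<mu>\<in>M - {\<mu>0}. hom_component v (scal (a \<mu>) (?r \<mu>))) \<in> N"
        using rN hom_component_form[OF rf]
        by (intro ideal_sum[OF N]) (auto simp: hom_component_scal intro: ideal_smult[OF N] ideal_0[OF N])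
      from ideal_diff[OF N * this] have "scal (a \<mu>0) (?r \<mu>0) \<in> N" by simp
      from ideal_smult[OF N this, of "[:inverse (a \<mu>0):]"] have "?r \<mu>0 \<in> N" using \<mu>0(2)
        by (simp add: one_pCons[symmetric])
      hence "?r ` M \<subseteq> N" using rN by blast
      hence "I \<subseteq> N" using M ideal_gen_least[OF N] by blast
      moreover have "N \<subseteq> I" unfolding N_def using reduced_in MC by (intro ideal_gen_least ideal) blast
      ultimately have "?Q (M - {\<mu>0})" using M unfolding N_def by blast
      from least[OF this] show False using \<mu>0(1) fin by (metis card_Diff1_less leD)
    qed
  qed
  thus ?thesis using M by blast
qed

end

section \<open>Semicontinuity of the number of generators\<close>

lemma spanning_open_step:
  fixes A S q t y :: "'a::field"
  shows "A - S * y = t - q * y \<Longrightarrow> A + (q - S) * y = t"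
  by (simp add: algebra_simps)

text \<open>
  That the rows of a matrix of functions span the whole space is an open condition. One step of
  fraction-free Gaussian elimination keeps the entries inside the given ring of functions, and the
  product of the pivots is the function sought.
\<close>

lemma spanning_open:
  fixes R :: "('b \<Rightarrow> 'a::field) set" and V :: "'t \<Rightarrow> 'n \<Rightarrow> 'b \<Rightarrow> 'a"
  assumes one: "(\<lambda>x. 1) \<in> R" and mult: "\<And>f g. f \<in> R \<Longrightarrow> g \<in> R \<Longrightarrow> (\<lambda>x. f x * g x) \<in> R"
    and diff: "\<And>f g. f \<in> R \<Longrightarrow> g \<in> R \<Longrightarrow> (\<lambda>x. f x - g x) \<in> R"
  assumes "finite N" and "finite T" "\<And>\<tau> \<nu>. \<tau> \<in> T \<Longrightarrow> \<nu> \<in> N \<Longrightarrow> V \<tau> \<nu> \<in> R"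
    and "\<And>t. \<exists>l. \<forall>\<nu>\<in>N. (\<Sum>\<tau>\<in>T. l \<tau> * V \<tau> \<nu> x0) = t \<nu>"
  shows "\<exists>\<phi>\<in>R. \<phi> x0 \<noteq> 0 \<and> (\<forall>x. \<phi> x \<noteq> 0 \<longrightarrow> (\<forall>t. \<exists>l. \<forall>\<nu>\<in>N. (\<Sum>\<tau>\<in>T. l \<tau> * V \<tau> \<nu> x) = t \<nu>))"
  using assms(4-)
proof (induction N arbitrary: V rule: finite_induct)
  case empty
  show ?case using one by (intro bexI[of _ "\<lambda>x. 1"]) auto
next
  case (insert \<nu>0 N)
  obtain l0 where "(\<Sum>\<tau>\<in>T. l0 \<tau> * V \<tau> \<nu>0 x0) = 1"
    using insert.prems(3)[of "\<lambda>_. 1"] by auto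
  then obtain \<tau>0 where \<tau>0: "\<tau>0 \<in> T" "V \<tau>0 \<nu>0 x0 \<noteq> 0"
    by (metis (no_types, lifting) mult_zero_right sum.neutral zero_neq_one)
  \<comment> \<open>elimination of the column \<open>\<nu>0\<close> with the pivot \<open>V \<tau>0 \<nu>0\<close>, without division\<close>
  define W where "W \<tau> \<nu> x = V \<tau>0 \<nu>0 x * V \<tau> \<nu> x - V \<tau> \<nu>0 x * V \<tau>0 \<nu> x" for \<tau> \<nu> x
  have Wsum: "(\<Sum>\<tau>\<in>T. l \<tau> * W \<tau> \<nu> x) =
      V \<tau>0 \<nu>0 x * (\<Sum>\<tau>\<in>T. l \<tau> * V \<tau> \<nu> x) - (\<Sum>\<tau>\<in>T. l \<tau> * V \<tau> \<nu>0 x) * V \<tau>0 \<nu> x" for l \<nu> x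
    by (simp only: W_def right_diff_distrib sum_subtractf sum_distrib_left sum_distrib_right mult_ac)
  have "\<exists>\<phi>\<in>R. \<phi> x0 \<noteq> 0 \<and> (\<forall>x. \<phi> x \<noteq> 0 \<longrightarrow> (\<forall>t. \<exists>l. \<forall>\<nu>\<in>N. (\<Sum>\<tau>\<in>T. l \<tau> * W \<tau> \<nu> x) = t \<nu>))"
  proof (rule insert.IH)
    show "W \<tau> \<nu> \<in> R" if "\<tau> \<in> T" "\<nu> \<in> N" for \<tau> \<nu>
      unfolding W_def using that \<tau>0 by (intro diff mult insert.prems) auto
    fix t
    obtain l where l: "\<forall>\<nu>\<in>insert \<nu>0 N. (\<Sum>\<tau>\<in>T. l \<tau> * V \<tau> \<nu> x0) = (if \<nu> = \<nu>0 then 0 else t \<nu> / V \<tau>0 \<nu>0 x0)"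
      using insert.prems(3)[of "\<lambda>\<nu>. if \<nu> = \<nu>0 then 0 else t \<nu> / V \<tau>0 \<nu>0 x0"] by blast
    have "(\<Sum>\<tau>\<in>T. l \<tau> * W \<tau> \<nu> x0) = t \<nu>" if "\<nu> \<in> N" for \<nu>
      unfolding Wsum using l that \<tau>0(2) insert.hyps(2) by (auto split: if_splits)
    thus "\<exists>l. \<forall>\<nu>\<in>N. (\<Sum>\<tau>\<in>T. l \<tau> * W \<tau> \<nu> x0) = t \<nu>" by blast
  qed (fact insert.prems(1))
  then obtain \<phi> where \<phi>: "\<phi> \<in> R" "\<phi> x0 \<noteq> 0"
    "\<And>x t. \<phi> x \<noteq> 0 \<Longrightarrow> \<exists>l. \<forall>\<nu>\<in>N. (\<Sum>\<tau>\<in>T. l \<tau> * W \<tau> \<nu> x) = t \<nu>" by blast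
  show ?case
  proof (intro bexI[of _ "\<lambda>x. \<phi> x * V \<tau>0 \<nu>0 x"] conjI allI impI)
    show "(\<lambda>x. \<phi> x * V \<tau>0 \<nu>0 x) \<in> R" using \<phi> \<tau>0 by (intro mult insert.prems) auto
    show "\<phi> x0 * V \<tau>0 \<nu>0 x0 \<noteq> 0" using \<phi> \<tau>0 by simp
    fix x t assume "\<phi> x * V \<tau>0 \<nu>0 x \<noteq> 0"
    hence x: "\<phi> x \<noteq> 0" "V \<tau>0 \<nu>0 x \<noteq> 0" by auto
    obtain l where l: "\<And>\<nu>. \<nu> \<in> N \<Longrightarrow> (\<Sum>\<tau>\<in>T. l \<tau> * W \<tau> \<nu> x) = t \<nu> - t \<nu>0 / V \<tau>0 \<nu>0 x * V \<tau>0 \<nu> x"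
      using \<phi>(3)[OF x(1), of "\<lambda>\<nu>. t \<nu> - t \<nu>0 / V \<tau>0 \<nu>0 x * V \<tau>0 \<nu> x"] by blast
    define e where "e = t \<nu>0 / V \<tau>0 \<nu>0 x - (\<Sum>\<sigma>\<in>T. l \<sigma> * V \<sigma> \<nu>0 x)"
    let ?l = "\<lambda>\<tau>. V \<tau>0 \<nu>0 x * l \<tau> + (if \<tau> = \<tau>0 then e else 0)"
    have sum: "(\<Sum>\<tau>\<in>T. ?l \<tau> * V \<tau> \<nu> x) = V \<tau>0 \<nu>0 x * (\<Sum>\<tau>\<in>T. l \<tau> * V \<tau> \<nu> x) + e * V \<tau>0 \<nu> x" for \<nu>
    proof -
      have "(\<Sum>\<tau>\<in>T. ?l \<tau> * V \<tau> \<nu> x) = (\<Sum>\<tau>\<in>T. V \<tau>0 \<nu>0 x * (l \<tau> * V \<tau> \<nu> x)) +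
          (\<Sum>\<tau>\<in>T. if \<tau> = \<tau>0 then e * V \<tau> \<nu> x else 0)"
        unfolding sum.distrib[symmetric] by (intro sum.cong refl) (simp only: distrib_right mult.assoc if_distrib[of "\<lambda>c. c * _"] mult_zero_left)
      also have "(\<Sum>\<tau>\<in>T. if \<tau> = \<tau>0 then e * V \<tau> \<nu> x else 0) = e * V \<tau>0 \<nu> x"
        using \<tau>0(1) insert.prems(1) by (subst sum.delta) auto
      finally show ?thesis by (simp only: sum_distrib_left)
    qed
    have "(\<Sum>\<tau>\<in>T. ?l \<tau> * V \<tau> \<nu> x) = t \<nu>" if "\<nu> \<in> insert \<nu>0 N" for \<nu>
    proof (cases "\<nu> = \<nu>0")
      case True
      thus ?thesis unfolding sum unfolding e_def using x(2) True by (simp add: algebra_simps)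
    next
      case False
      hence "\<nu> \<in> N" using that by simp
      from l[OF this] show ?thesis
        unfolding sum unfolding e_def Wsum by (rule spanning_open_step)
    qed
    thus "\<exists>l. \<forall>\<nu>\<in>insert \<nu>0 N. (\<Sum>\<tau>\<in>T. l \<tau> * V \<tau> \<nu> x) = t \<nu>"
      by (intro exI[of _ ?l] ballI)
  qed
qed

lemma regular_diff: "\<phi> \<in> regular_funs P \<Longrightarrow> \<psi> \<in> regular_funs P \<Longrightarrow> (\<lambda>I. \<phi> I - \<psi> I) \<in> regular_funs P"
  using regular_funs.add[of \<phi> P "\<lambda>I. (- 1) * \<psi> I"] regular_funs.mult[OF regular_funs.const[of "- 1" P], of \<psi>]
  by simp

lemma regular_if:
  "(c \<Longrightarrow> \<phi> \<in> regular_funs P) \<Longrightarrow> (\<not> c \<Longrightarrow> \<psi> \<in> regular_funs P) \<Longrightarrow>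
    (\<lambda>I. if c then \<phi> I else \<psi> I) \<in> regular_funs P"
  by (cases c) auto

text \<open>
  Take homogeneous generators of \<open>I0\<close> among its reduced elements, as few as possible, and consider
  the reduced elements with the same exponents in a nearby ideal. Up to a degree bound, their monomial
  multiples have regular coordinates with respect to the monomials outside the diagram. At \<open>I0\<close>
  these multiples span all such coordinate vectors, so they do so nearby, where they generate
  all reduced elements at the corners.
\<close>

theorem min_gens_semicontinuous:
  fixes I0 :: "'a::field poly poly set"
  assumes P: "is_partition P" and I0: "I0 \<in> jordan_cell P"
  shows "\<exists>\<phi>\<in>regular_funs P. \<phi> I0 \<noteq> 0 \<and> (\<forall>I\<in>jordan_cell P. \<phi> I \<noteq> 0 \<longrightarrow> min_gens I \<le> min_gens I0)"
proof -
  interpret I0: cell_ideal P I0 by standard fact+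
  obtain M where M: "M \<subseteq> corners P" "ideal_gen (reduced_elem P I0 ` M) = I0" "card M \<le> min_gens I0"
    using I0.minimal_corner_generators by blast
  have finM: "finite M" using M(1) finite_corners finite_subset by blast
  have MC: "\<mu> \<notin> C_set P" if "\<mu> \<in> M" for \<mu> using that M(1) corners_notin_C by blast
  \<comment> \<open>any bound for the degrees of the corners will do\<close>
  define D where "D = (\<Sum>\<mu>\<in>corners P. fst \<mu> + snd \<mu>)"
  have D: "fst \<mu> + snd \<mu> \<le> D" if "\<mu> \<in> corners P" for \<mu>
    unfolding D_def using that finite_corners by (intro member_le_sum) auto
  define N where "N = {\<nu>. \<nu> \<notin> C_set P \<and> fst \<nu> + snd \<nu> \<le> D}"
  define T where "T = {(\<kappa>, \<mu>). \<mu> \<in> M \<and> fst \<kappa> + snd \<kappa> + (fst \<mu> + snd \<mu>) \<le> D}"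
  have finN: "finite N"
    by (rule finite_subset[of _ "{..D} \<times> {..D}"]) (auto simp: N_def)
  have finT: "finite T"
    by (rule finite_subset[of _ "({..D} \<times> {..D}) \<times> M"]) (auto simp: T_def finM)
  define w where "w I \<tau> = mono_xy (fst \<tau>) * reduced_elem P I (snd \<tau>)" for I :: "'a poly poly set" and \<tau>
  \<comment> \<open>The coordinates of \<open>w I \<tau>\<close> outside the diagram. The known values of reduced elements are
    inserted explicitly, because regular functions are functions of arbitrary sets \<open>I\<close>.\<close>
  define V where "V \<tau> \<nu> I = (let i = fst (fst \<tau>); j = snd (fst \<tau>); a = fst \<nu>; b = snd \<nu> in
     if i \<le> a \<and> j \<le> b then if (a - i, b - j) \<in> C_set P then coef_xy (reduced_elem P I (snd \<tau>)) (a - i, b - j)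
       else if (a - i, b - j) = snd \<tau> then 1 else 0 else 0)" for \<tau> \<nu> and I :: "'a poly poly set"
  have VR: "V \<tau> \<nu> \<in> regular_funs P" if "\<tau> \<in> T" for \<tau> \<nu>
  proof -
    have "snd \<tau> \<notin> C_set P" using MC that by (auto simp: T_def)
    thus ?thesis unfolding V_def Let_def
      by (intro regular_if regular_funs.const regular_funs.coord)
  qed
  have Vw: "V \<tau> \<nu> I = coef_xy (w I \<tau>) \<nu>" if "\<tau> \<in> T" "I \<in> jordan_cell P" for \<tau> \<nu> I
  proof -
    interpret cell_ideal P I by standard fact+
    obtain i j \<mu> where \<tau>: "\<tau> = ((i, j), \<mu>)" by (metis prod.collapse)
    obtain a b where \<nu>: "\<nu> = (a, b)" by (cases \<nu>)
    have "\<mu> \<notin> C_set P" using MC that by (auto simp: T_def \<tau>)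
    from coef_reduced[OF this, of "(a - i, b - j)"] show ?thesis
      by (auto simp: V_def w_def Let_def coef_xy_mono_mult \<tau> \<nu>)
  qed
  have w_forms: "\<exists>v\<le>D. w I \<tau> \<in> forms v" if "\<tau> \<in> T" "I \<in> jordan_cell P" for \<tau> I
  proof -
    interpret cell_ideal P I by standard fact+
    obtain i j \<mu> where \<tau>: "\<tau> = ((i, j), \<mu>)" by (metis prod.collapse)
    have "\<mu> \<notin> C_set P" using MC that by (auto simp: T_def \<tau>)
    from forms_mono_mult[OF reduced_forms[OF this], of i j] that show ?thesis
      by (intro exI[of _ "i + j + (fst \<mu> + snd \<mu>)"]) (auto simp: w_def T_def \<tau>)
  qed
  have span0: "\<exists>l. \<forall>\<nu>\<in>N. (\<Sum>\<tau>\<in>T. l \<tau> * V \<tau> \<nu> I0) = t \<nu>" for t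
  proof -
    let ?W = "kvs.span (w I0 ` T)"
    have rW: "reduced_elem P I0 \<nu> \<in> ?W" if \<nu>: "\<nu> \<in> N" for \<nu>
    proof -
      let ?v = "fst \<nu> + snd \<nu>"
      have nC: "\<nu> \<notin> C_set P" using \<nu> by (simp add: N_def)
      obtain h where h: "reduced_elem P I0 \<nu> = (\<Sum>\<mu>\<in>M. h \<mu> * reduced_elem P I0 \<mu>)"
        using ideal_gen_finite[OF finM] I0.reduced_in[OF nC] M(2) by metis
      have "reduced_elem P I0 \<nu> = hom_component ?v (reduced_elem P I0 \<nu>)"
        using hom_component_form[OF I0.reduced_forms[OF nC]] by simp
      also have "\<dots> = (\<Sum>\<mu>\<in>M. hom_component ?v (h \<mu> * reduced_elem P I0 \<mu>))"
        by (subst h) (rule hom_component_sum)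
      also have "\<dots> \<in> ?W"
      proof (rule kvs.span_sum)
        fix \<mu> assume \<mu>: "\<mu> \<in> M"
        let ?w = "fst \<mu> + snd \<mu>"
        show "hom_component ?v (h \<mu> * reduced_elem P I0 \<mu>) \<in> ?W"
        proof (cases "?w \<le> ?v")
          case False
          thus ?thesis using hom_component_mult[OF I0.reduced_forms[OF MC[OF \<mu>]], of ?v "h \<mu>"]
            by (simp add: kvs.span_zero)
        next
          case True
          let ?g = "hom_component (?v - ?w) (h \<mu>)"
          have "?g = (\<Sum>\<kappa>\<in>{\<kappa>. coef_xy ?g \<kappa> \<noteq> 0}. scal (coef_xy ?g \<kappa>) (mono_xy \<kappa>))"
            by (rule mono_expansion[OF finite_support]) auto
          hence "?g * reduced_elem P I0 \<mu> =
             (\<Sum>\<kappa>\<in>{\<kappa>. coef_xy ?g \<kappa> \<noteq> 0}. scal (coef_xy ?g \<kappa>) (mono_xy \<kappa>)) * reduced_elem P I0 \<mu>"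
            by (rule arg_cong)
          also have "\<dots> = (\<Sum>\<kappa>\<in>{\<kappa>. coef_xy ?g \<kappa> \<noteq> 0}. scal (coef_xy ?g \<kappa>) (w I0 (\<kappa>, \<mu>)))"
            by (simp add: sum_distrib_right w_def)
          also have "\<dots> \<in> ?W"
          proof (intro kvs.span_sum kvs.span_scale kvs.span_base imageI)
            fix \<kappa> assume "\<kappa> \<in> {\<kappa>. coef_xy ?g \<kappa> \<noteq> 0}"
            hence "fst \<kappa> + snd \<kappa> = ?v - ?w"
              using formsD[OF hom_component_forms, of "?v - ?w" "h \<mu>" "fst \<kappa>" "snd \<kappa>"] by simp
            thus "(\<kappa>, \<mu>) \<in> T" using \<mu> \<nu> True by (auto simp: T_def N_def)
          qed
          finally show ?thesis
            using hom_component_mult[OF I0.reduced_forms[OF MC[OF \<mu>]], of ?v "h \<mu>"] True by simp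
        qed
      qed
      finally show ?thesis .
    qed
    let ?f = "\<Sum>\<nu>\<in>N. scal (t \<nu>) (reduced_elem P I0 \<nu>)"
    have "?f \<in> ?W" by (intro kvs.span_sum kvs.span_scale rW)
    then obtain l where l: "?f = (\<Sum>\<tau>\<in>T. scal (l \<tau>) (w I0 \<tau>))"
      using kvs.span_image_finite[OF finT] by blast
    have "(\<Sum>\<tau>\<in>T. l \<tau> * V \<tau> \<nu> I0) = t \<nu>" if \<nu>: "\<nu> \<in> N" for \<nu>
    proof -
      have "(\<Sum>\<tau>\<in>T. l \<tau> * V \<tau> \<nu> I0) = coef_xy ?f \<nu>"
        unfolding l by (simp add: Vw I0)
      also have "\<dots> = (\<Sum>\<nu>'\<in>N. if \<nu>' = \<nu> then t \<nu>' else 0)"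
        unfolding coef_xy_sum
      proof (intro sum.cong refl)
        fix \<nu>' assume "\<nu>' \<in> N"
        hence "\<nu>' \<notin> C_set P" "\<nu> \<notin> C_set P" using \<nu> by (auto simp: N_def)
        thus "coef_xy (scal (t \<nu>') (reduced_elem P I0 \<nu>')) \<nu> = (if \<nu>' = \<nu> then t \<nu>' else 0)"
          using I0.coef_reduced by simp
      qed
      also have "\<dots> = t \<nu>" using \<nu> finN by simp
      finally show ?thesis .
    qed
    thus ?thesis by blast
  qed
  obtain \<phi> where \<phi>: "\<phi> \<in> regular_funs P" "\<phi> I0 \<noteq> 0"
    "\<And>I t. \<phi> I \<noteq> 0 \<Longrightarrow> \<exists>l. \<forall>\<nu>\<in>N. (\<Sum>\<tau>\<in>T. l \<tau> * V \<tau> \<nu> I) = t \<nu>"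
    using spanning_open[of "regular_funs P" N T V I0, OF regular_funs.const regular_funs.mult regular_diff finN finT VR span0]
    by blast
  have "min_gens I \<le> min_gens I0" if I: "I \<in> jordan_cell P" "\<phi> I \<noteq> 0" for I
  proof -
    interpret cell_ideal P I by standard fact+
    let ?J = "ideal_gen (reduced_elem P I ` M)"
    have wJ: "w I \<tau> \<in> ?J" if "\<tau> \<in> T" for \<tau>
      unfolding w_def using that
      by (intro ideal_mult is_ideal_gen subsetD[OF ideal_gen_superset]) (auto simp: T_def)
    have JI: "?J \<subseteq> I" using reduced_in MC by (intro ideal_gen_least ideal) blast
    have "reduced_elem P I \<mu> \<in> ?J" if \<mu>: "\<mu> \<in> corners P" for \<mu>
    proof -
      obtain l where l: "\<And>\<nu>. \<nu> \<in> N \<Longrightarrow> (\<Sum>\<tau>\<in>T. l \<tau> * V \<tau> \<nu> I) = (if \<nu> = \<mu> then 1 else 0)"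
        using \<phi>(3)[OF I(2), of "\<lambda>\<nu>. if \<nu> = \<mu> then 1 else 0"] by blast
      let ?f = "\<Sum>\<tau>\<in>T. scal (l \<tau>) (w I \<tau>)"
      have fJ: "?f \<in> ?J" by (intro ideal_sum ideal_smult is_ideal_gen wJ)
      have "?f = reduced_elem P I \<mu>"
      proof (rule eqI)
        show "?f \<in> I" using fJ JI by blast
        show "reduced_elem P I \<mu> \<in> I" using \<mu> corners_notin_C reduced_in by blast
        fix \<nu> assume \<nu>: "\<nu> \<notin> C_set P"
        show "coef_xy ?f \<nu> = coef_xy (reduced_elem P I \<mu>) \<nu>"
        proof (cases "fst \<nu> + snd \<nu> \<le> D")
          case True
          hence "\<nu> \<in> N" using \<nu> by (simp add: N_def)
          from l[OF this] coef_reduced[OF corners_notin_C[OF \<mu>] \<nu>] show ?thesis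
            by (simp add: Vw I)
        next
          case False
          have "coef_xy (w I \<tau>) \<nu> = 0" if \<tau>: "\<tau> \<in> T" for \<tau>
          proof -
            obtain v where "v \<le> D" "w I \<tau> \<in> forms v" using w_forms[OF \<tau> I(1)] by blast
            thus ?thesis using formsD[of "w I \<tau>" v "fst \<nu>" "snd \<nu>"] False by auto
          qed
          moreover have "\<nu> \<noteq> \<mu>" using D[OF \<mu>] False by auto
          ultimately show ?thesis using coef_reduced[OF corners_notin_C[OF \<mu>] \<nu>] by simp
        qed
      qed
      thus ?thesis using fJ by simp
    qed
    hence "reduced_elem P I ` corners P \<subseteq> ?J" by blast
    hence "I \<subseteq> ?J" using ideal_gen_least[of ?J "reduced_elem P I ` corners P"] generated_by_corners by auto
    with JI have "?J = I" by blast
    hence "min_gens I \<le> card (reduced_elem P I ` M)" using finM by (intro min_gens_le) auto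
    also have "\<dots> \<le> card M" by (rule card_image_le[OF finM])
    finally show ?thesis using M(3) by simp
  qed
  with \<phi> show ?thesis by blast
qed

section \<open>The generic number of generators\<close>

definition principal_open :: "nat list \<Rightarrow> ('a::field poly poly set \<Rightarrow> 'a) \<Rightarrow> 'a poly poly set set" where
  "principal_open P \<phi> = {I \<in> jordan_cell P. \<phi> I \<noteq> 0}"

lemma openin_principal_open: "\<phi> \<in> regular_funs P \<Longrightarrow> openin (zariski_cell P) (principal_open P \<phi>)"
  unfolding zariski_cell_def principal_open_def by (rule topology_generated_by_Basis) blast

lemma topspace_zariski_cell: "topspace (zariski_cell P) = jordan_cell P"
proof -
  have "I \<in> jordan_cell P \<Longrightarrow> \<exists>\<phi>\<in>regular_funs P. \<phi> I \<noteq> 0" for I :: "'a poly poly set"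
    by (intro bexI[of _ "\<lambda>_. 1"] regular_funs.const) auto
  thus ?thesis unfolding zariski_cell_def topology_generated_by_topspace by blast
qed

text \<open>
  Finite intersections of principal open sets are principal, by multiplication of functions.
\<close>

lemma zariski_cell_basis:
  assumes "openin (zariski_cell P) V" "I \<in> V"
  shows "\<exists>\<phi>\<in>regular_funs P. I \<in> principal_open P \<phi> \<and> principal_open P \<phi> \<subseteq> V"
proof -
  have "generate_topology_on {{I \<in> jordan_cell P. \<phi> I \<noteq> 0} |\<phi>. \<phi> \<in> regular_funs P} V"
    using assms(1) unfolding zariski_cell_def by (simp add: openin_topology_generated_by_iff)
  thus ?thesis using assms(2)
  proof (induction arbitrary: I rule: generate_topology_on.induct)
    case (Int V W)
    then obtain \<phi> \<psi> where "\<phi> \<in> regular_funs P" "I \<in> principal_open P \<phi>" "principal_open P \<phi> \<subseteq> V"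
       "\<psi> \<in> regular_funs P" "I \<in> principal_open P \<psi>" "principal_open P \<psi> \<subseteq> W" by blast
    thus ?case
      by (intro bexI[of _ "\<lambda>I. \<phi> I * \<psi> I"] regular_funs.mult) (auto simp: principal_open_def)
  next
    case (UN K)
    then obtain k where "k \<in> K" "I \<in> k" by blast
    from UN.IH[OF this] \<open>k \<in> K\<close> show ?case by blast
  qed (auto simp: principal_open_def)
qed

text \<open>
  The locus where the minimum is attained contains a nonempty principal open set, which is dense by
  irreducibility. Uniqueness of the generic value holds because a dense set meets this open set.
\<close>

theorem kappa_eq_min:
  fixes I0 :: "'a::field poly poly set"
  assumes inf: "infinite (UNIV :: 'a set)" and P: "is_partition P" and I0: "I0 \<in> jordan_cell P"
    and least: "\<And>I. I \<in> jordan_cell P \<Longrightarrow> min_gens I0 \<le> min_gens (I :: 'a poly poly set)"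
  shows "kappa TYPE('a) P = min_gens I0"
proof -
  obtain \<phi> where \<phi>: "\<phi> \<in> regular_funs P" "\<phi> I0 \<noteq> 0"
    "\<And>I. I \<in> jordan_cell P \<Longrightarrow> \<phi> I \<noteq> 0 \<Longrightarrow> min_gens I \<le> min_gens I0"
    using min_gens_semicontinuous[OF P I0] by blast
  let ?U = "principal_open P \<phi>"
  have U: "openin (zariski_cell P) ?U" "?U \<noteq> {}" "\<forall>I\<in>?U. min_gens I = min_gens I0"
    using openin_principal_open[OF \<phi>(1)] \<phi>(2,3) I0 least
    by (auto simp: principal_open_def intro: antisym)
  have "zariski_cell P closure_of ?U = topspace (zariski_cell P)"
  proof (rule antisym[OF closure_of_subset_topspace], rule subsetI)
    fix J assume J: "J \<in> topspace (zariski_cell P :: 'a poly poly set topology)"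
    show "J \<in> zariski_cell P closure_of ?U" unfolding in_closure_of
    proof (intro conjI J allI impI)
      fix V assume "J \<in> V \<and> openin (zariski_cell P) V"
      then obtain \<psi> where \<psi>: "\<psi> \<in> regular_funs P" "J \<in> principal_open P \<psi>" "principal_open P \<psi> \<subseteq> V"
        using zariski_cell_basis by blast
      have "\<exists>K\<in>jordan_cell P. \<phi> K \<noteq> 0 \<and> \<psi> K \<noteq> 0"
        by (rule cell_irreducible[OF inf P I0 _ \<phi>(1,2) \<psi>(1)]) (use \<psi>(2) in \<open>auto simp: principal_open_def\<close>)
      thus "\<exists>K. K \<in> ?U \<and> K \<in> V" using \<psi>(3) by (auto simp: principal_open_def)
    qed
  qed
  with U have gen: "generically P (\<lambda>I :: 'a poly poly set. min_gens I = min_gens I0)"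
    unfolding generically_def by blast
  show ?thesis unfolding kappa_def
  proof (rule the_equality, rule gen)
    fix n assume "generically P (\<lambda>I :: 'a poly poly set. min_gens I = n)"
    then obtain W where W: "zariski_cell P closure_of W = topspace (zariski_cell P)"
      "\<forall>I\<in>W. min_gens (I :: 'a poly poly set) = n" unfolding generically_def by blast
    have "I0 \<in> zariski_cell P closure_of W" using I0 by (simp add: W(1) topspace_zariski_cell)
    moreover have "I0 \<in> ?U" using I0 \<phi>(2) by (simp add: principal_open_def)
    ultimately obtain K where "K \<in> W" "K \<in> ?U" using U(1) unfolding in_closure_of by blast
    thus "n = min_gens I0" using W(2) U(3) by auto
  qed
qed

section \<open>The Hilbert function of a monomial ideal\<close>

lemma inj_mono_xy: "inj (mono_xy :: expo \<Rightarrow> 'a::field poly poly)"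
proof (rule injI)
  fix \<mu> \<nu> assume "mono_xy \<mu> = (mono_xy \<nu> :: 'a poly poly)"
  from arg_cong[OF this, of "\<lambda>f. coef_xy f \<mu>"] show "\<mu> = \<nu>" by (auto split: if_splits)
qed

text \<open>
  The two spaces whose dimensions are subtracted in the Hilbert function of a monomial ideal are
  of this form.
\<close>

lemma dim_k_supported:
  assumes "finite A"
  shows "dim_k {f :: 'a::field poly poly. \<forall>\<nu>. coef_xy f \<nu> \<noteq> 0 \<longrightarrow> \<nu> \<in> A} = card A"
proof -
  let ?B = "mono_xy ` A :: 'a poly poly set"
  have fin: "finite ?B" using assms by simp
  have "\<not> kvs.dependent ?B"
  proof (rule kvs.independent_if_scalars_zero[OF fin])
    fix u :: "'a poly poly \<Rightarrow> 'a" and x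
    assume eq: "(\<Sum>x\<in>?B. scal (u x) x) = 0" and "x \<in> ?B"
    then obtain \<mu> where \<mu>: "\<mu> \<in> A" "x = mono_xy \<mu>" by blast
    have "(\<Sum>x\<in>?B. scal (u x) x) = (\<Sum>\<nu>\<in>A. scal (u (mono_xy \<nu>)) (mono_xy \<nu>))"
      by (subst sum.reindex) (auto intro: inj_on_subset[OF inj_mono_xy])
    hence "coef_xy (\<Sum>\<nu>\<in>A. scal (u (mono_xy \<nu>)) (mono_xy \<nu>)) \<mu> = 0" using eq by simp
    moreover have "coef_xy (\<Sum>\<nu>\<in>A. scal (u (mono_xy \<nu>)) (mono_xy \<nu>)) \<mu> =
        (\<Sum>\<nu>\<in>A. if \<nu> = \<mu> then u (mono_xy \<nu>) else 0)"
      unfolding coef_xy_sum by (intro sum.cong) auto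
    ultimately show "u x = 0" using \<mu> assms by simp
  qed
  moreover have "kvs.span ?B = {f. \<forall>\<nu>. coef_xy f \<nu> \<noteq> 0 \<longrightarrow> \<nu> \<in> A}" (is "_ = ?V")
  proof
    have "kvs.subspace ?V" unfolding kvs.subspace_def
      by (auto simp del: split_paired_All) (metis add.right_neutral)
    thus "kvs.span ?B \<subseteq> ?V" by (intro kvs.span_minimal) (auto split: if_splits)
    show "?V \<subseteq> kvs.span ?B"
    proof
      fix f assume "f \<in> ?V"
      hence "f = (\<Sum>\<nu>\<in>A. scal (coef_xy f \<nu>) (mono_xy \<nu>))"
        using mono_expansion[OF assms, of f] by blast
      also have "\<dots> \<in> kvs.span ?B"
        by (intro kvs.span_sum kvs.span_scale kvs.span_base imageI)
      finally show "f \<in> kvs.span ?B" .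
    qed
  qed
  ultimately have "dim_k ?V = card ?B"
    unfolding dim_k_def using kvs.dim_span_eq_card_independent[of ?B] by simp
  thus ?thesis by (simp add: card_image inj_on_subset[OF inj_mono_xy])
qed

lemma degree_exponents: "{\<nu> :: expo. fst \<nu> + snd \<nu> = i \<and> Q \<nu>} = (\<lambda>b. (i - b, b)) ` {b. b \<le> i \<and> Q (i - b, b)}"
proof (rule set_eqI)
  fix \<nu> :: expo
  obtain a b where "\<nu> = (a, b)" by (cases \<nu>)
  thus "\<nu> \<in> {\<nu> :: expo. fst \<nu> + snd \<nu> = i \<and> Q \<nu>} \<longleftrightarrow> \<nu> \<in> (\<lambda>b. (i - b, b)) ` {b. b \<le> i \<and> Q (i - b, b)}"
    by (auto simp: image_iff)
qed

lemma card_degree_exponents: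
  "card {\<nu> :: expo. fst \<nu> + snd \<nu> = i \<and> Q \<nu>} = card {b. b \<le> i \<and> Q (i - b, b)}"
  unfolding degree_exponents by (rule card_image) (auto simp: inj_on_def)

lemma hilbert_quot_E_ideal:
  assumes "is_partition P"
  shows "hilbert_quot (E_ideal P :: 'a::field poly poly set) i = card {b. b \<le> i \<and> i < edeg P b}"
proof -
  let ?A = "{\<nu> :: expo. fst \<nu> + snd \<nu> = i \<and> True}" and ?B = "{\<nu>. fst \<nu> + snd \<nu> = i \<and> \<nu> \<notin> C_set P}"
  have fA: "finite ?A" unfolding degree_exponents by simp
  have fB: "finite ?B" unfolding degree_exponents by simp
  have A: "forms i = {f :: 'a poly poly. \<forall>\<nu>. coef_xy f \<nu> \<noteq> 0 \<longrightarrow> \<nu> \<in> ?A}"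
    by (auto simp: forms_def)
  have B: "E_ideal P \<inter> forms i = {f :: 'a poly poly. \<forall>\<nu>. coef_xy f \<nu> \<noteq> 0 \<longrightarrow> \<nu> \<in> ?B}"
    by (auto simp: forms_def E_ideal_iff[OF assms])
  have "hilbert_quot (E_ideal P :: 'a poly poly set) i = card ?A - card ?B"
    unfolding hilbert_quot_def B unfolding A dim_k_supported[OF fA] dim_k_supported[OF fB] ..
  also have "card ?B = card {b. b \<le> i \<and> \<not> i < edeg P b}"
    unfolding card_degree_exponents
    by (rule arg_cong[of _ _ card]) (auto simp: C_set_iff edeg_def)
  also have "card ?A - \<dots> = card ({b. b \<le> i} - {b. b \<le> i \<and> \<not> i < edeg P b})"
    unfolding card_degree_exponents by (subst card_Diff_subset) auto
  also have "{b. b \<le> i} - {b. b \<le> i \<and> \<not> i < edeg P b} = {b. b \<le> i \<and> i < edeg P b}" by auto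
  finally show ?thesis .
qed

text \<open>
  Truncated subtraction makes the last term vanish beyond the socle degree.
\<close>

lemma T_seq_eq:
  assumes "d \<ge> 1" "k \<ge> 1"
  shows "T_seq d k i = min (min (Suc i) d) (2 * d + k - 2 - i)"
proof -
  have up: "nth_default 0 [1..<d] j = (if j < d - 1 then Suc j else 0)" for j
    by (simp add: nth_default_def)
  have mid: "nth_default 0 (replicate k d) j = (if j < k then d else 0)" for j
    by (simp add: nth_default_def)
  have down: "nth_default 0 (rev [1..<d]) j = d - 1 - j" for j
    by (cases "j < d - 1") (auto simp: nth_default_def rev_nth)
  have eq: "T_seq d k i =
      (if i < d - 1 then Suc i else if i - (d - 1) < k then d else d - 1 - (i - (d - 1) - k))"
    unfolding T_seq_def nth_default_append up mid down by simp
  consider "i < d - 1" | "\<not> i < d - 1" "i - (d - 1) < k" | "\<not> i < d - 1" "\<not> i - (d - 1) < k"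
    by blast
  thus ?thesis
  proof cases
    case 1
    hence "Suc i \<le> d" "Suc i \<le> 2 * d + k - 2 - i" using assms by linarith+
    thus ?thesis using 1 eq by simp
  next
    case 2
    hence "d \<le> Suc i" "d \<le> 2 * d + k - 2 - i" using assms by linarith+
    thus ?thesis using 2 eq by simp
  next
    case 3
    hence "2 * d + k - 2 - i \<le> Suc i" "2 * d + k - 2 - i \<le> d"
      "d - 1 - (i - (d - 1) - k) = 2 * d + k - 2 - i" using assms by linarith+
    thus ?thesis using 3 eq by simp
  qed
qed

lemma has_diagonal_lengths_iff:
  assumes "is_partition P" "d \<ge> 1" "k \<ge> 1"
  shows "has_diagonal_lengths K P (T_seq d k) \<longleftrightarrow>
    (\<forall>i. card {b. b \<le> i \<and> i < edeg P b} = min (min (Suc i) d) (2 * d + k - 2 - i))"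
  using assms by (simp add: has_diagonal_lengths_def fun_eq_iff hilbert_quot_E_ideal T_seq_eq)

section \<open>Partitions whose rows end in consecutive degrees\<close>

text \<open>
  With \<open>{m, lo} = {d, d + k - 1}\<close> these will turn out to be the complete intersection Jordan types. The
  largest end degree is then the degree after the socle degree in either case.
\<close>

definition staircase :: "nat \<Rightarrow> nat \<Rightarrow> nat list set" where
  "staircase m lo = {P. is_partition P \<and> length P = m \<and> bij_betw (edeg P) {..<m} {lo..<lo + m}}"

lemma edeg_gt: "is_partition P \<Longrightarrow> b < length P \<Longrightarrow> b < edeg P b"
  using row_pos_iff[of P b] by (simp add: edeg_def)

lemma edeg_beyond: "length P \<le> b \<Longrightarrow> edeg P b = b"
  by (simp add: edeg_def nth_default_def)

lemma edeg_Suc_le: "is_partition P \<Longrightarrow> edeg P (Suc b) \<le> Suc (edeg P b)"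
  using row_antimono[of P b "Suc b"] by (simp add: edeg_def)

text \<open>
  Both sides count the rows \<open>b < m\<close> with \<open>b \<le> i\<close>: those that reach the diagonal \<open>i\<close> and those that
  end before it.
\<close>

lemma diagonal_count:
  assumes "is_partition P" "length P = m"
  shows "card {b. b \<le> i \<and> i < edeg P b} + card {b. b < m \<and> edeg P b < Suc i} = min m (Suc i)"
proof -
  have "{b. b \<le> i \<and> i < edeg P b} \<union> {b. b < m \<and> edeg P b < Suc i} = {..<min m (Suc i)}"
  proof (rule set_eqI)
    fix b
    show "b \<in> {b. b \<le> i \<and> i < edeg P b} \<union> {b. b < m \<and> edeg P b < Suc i} \<longleftrightarrow> b \<in> {..<min m (Suc i)}"
      using edeg_gt[OF assms(1), of b] edeg_beyond[of P b] assms(2) by (cases "b < m") auto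
  qed
  moreover have "{b. b \<le> i \<and> i < edeg P b} \<inter> {b. b < m \<and> edeg P b < Suc i} = {}" by auto
  ultimately show ?thesis
    by (subst card_Un_disjoint[symmetric]) auto
qed

text \<open>
  By \<open>diagonal_count\<close>, the diagonal lengths tell how many rows end in degrees up to \<open>i\<close>, and hence
  how many end exactly in degree \<open>i\<close>.
\<close>

lemma diagonal_lengths_iff_staircase:
  assumes P: "is_partition P" "length P = m" and "m \<ge> 1" "lo \<ge> 1"
  shows "(\<forall>i. card {b. b \<le> i \<and> i < edeg P b} = min (min (Suc i) (min m lo)) (m + lo - 1 - i))
    \<longleftrightarrow> P \<in> staircase m lo"
proof -
  have "(\<forall>i. card {b. b \<le> i \<and> i < edeg P b} = min (min (Suc i) (min m lo)) (m + lo - 1 - i)) \<longleftrightarrow>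
        (\<forall>i. card {b. b < m \<and> edeg P b < Suc i} = min m (Suc i - lo))"
  proof (rule iff_allI)
    fix i
    have "min m (Suc i) = min (min (Suc i) (min m lo)) (m + lo - 1 - i) + min m (Suc i - lo)"
      using assms(3,4)
      by (cases "Suc i \<le> lo"; cases "Suc i \<le> m"; cases "Suc i \<le> m + lo") (simp_all add: min_def, (intro conjI impI; linarith)+)
    with diagonal_count[OF P, of i]
    show "card {b. b \<le> i \<and> i < edeg P b} = min (min (Suc i) (min m lo)) (m + lo - 1 - i) \<longleftrightarrow>
        card {b. b < m \<and> edeg P b < Suc i} = min m (Suc i - lo)" by linarith
  qed
  also have "\<dots> \<longleftrightarrow> bij_betw (edeg P) {..<m} {lo..<lo + m}"
  proof
    assume bij: "bij_betw (edeg P) {..<m} {lo..<lo + m}"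
    show "\<forall>i. card {b. b < m \<and> edeg P b < Suc i} = min m (Suc i - lo)"
    proof
      fix i
      have "bij_betw (edeg P) {b. b < m \<and> edeg P b < Suc i} {lo..<min (lo + m) (Suc i)}"
        unfolding bij_betw_def
      proof
        show "inj_on (edeg P) {b. b < m \<and> edeg P b < Suc i}"
          by (rule inj_on_subset[OF bij_betw_imp_inj_on[OF bij]]) auto
        show "edeg P ` {b. b < m \<and> edeg P b < Suc i} = {lo..<min (lo + m) (Suc i)}"
        proof -
          have "edeg P ` {b. b < m \<and> edeg P b < Suc i} = edeg P ` {..<m} \<inter> {..<Suc i}" by auto
          also have "\<dots> = {lo..<min (lo + m) (Suc i)}" unfolding bij_betw_imp_surj_on[OF bij] by auto
          finally show ?thesis .
        qed
      qed
      from bij_betw_same_card[OF this] show "card {b. b < m \<and> edeg P b < Suc i} = min m (Suc i - lo)"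
        by simp
    qed
  next
    assume *: "\<forall>i. card {b. b < m \<and> edeg P b < Suc i} = min m (Suc i - lo)"
    have lt: "card {b. b < m \<and> edeg P b < i} = min m (i - lo)" for i
      using * by (cases i) auto
    have eq: "card {b. b < m \<and> edeg P b = i} = (if lo \<le> i \<and> i < lo + m then 1 else 0)" for i
    proof -
      have "{b. b < m \<and> edeg P b < Suc i} = {b. b < m \<and> edeg P b < i} \<union> {b. b < m \<and> edeg P b = i}"
        by auto
      hence "min m (Suc i - lo) = card ({b. b < m \<and> edeg P b < i} \<union> {b. b < m \<and> edeg P b = i})"
        using * by metis
      also have "\<dots> = min m (i - lo) + card {b. b < m \<and> edeg P b = i}"
        unfolding lt[of i, symmetric] by (rule card_Un_disjoint) auto
      finally show ?thesis by auto
    qed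
    show "bij_betw (edeg P) {..<m} {lo..<lo + m}"
      unfolding bij_betw_def
    proof
      show "inj_on (edeg P) {..<m}"
      proof (rule inj_onI)
        fix b b' assume b: "b \<in> {..<m}" "b' \<in> {..<m}" "edeg P b = edeg P b'"
        have "card {b. b < m \<and> edeg P b = edeg P b'} \<le> 1" unfolding eq by simp
        moreover have "finite {b. b < m \<and> edeg P b = edeg P b'}" by simp
        ultimately show "b = b'" using b by (simp add: card_le_Suc0_iff_eq)
      qed
      show "edeg P ` {..<m} = {lo..<lo + m}"
      proof (rule set_eqI)
        fix v
        have "v \<in> edeg P ` {..<m} \<longleftrightarrow> {b. b < m \<and> edeg P b = v} \<noteq> {}" by auto
        also have "\<dots> \<longleftrightarrow> card {b. b < m \<and> edeg P b = v} \<noteq> 0" by auto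
        also have "\<dots> \<longleftrightarrow> v \<in> {lo..<lo + m}" unfolding eq by simp
        finally show "v \<in> edeg P ` {..<m} \<longleftrightarrow> v \<in> {lo..<lo + m}" .
      qed
    qed
  qed
  finally show ?thesis using P by (simp add: staircase_def)
qed

section \<open>Counting by removing the first run\<close>

lemma edeg_append:
  "edeg (replicate n p @ Q) b = (if b < n then p + b else edeg Q (b - n) + n)"
  by (auto simp: edeg_def nth_default_append)

lemma bij_betw_shift:
  assumes "n \<le> m" "n \<le> lo"
  shows "bij_betw (edeg (replicate n p @ Q)) {n..<m} {lo..<lo + m - n} \<longleftrightarrow>
     bij_betw (edeg Q) {..<m - n} {lo - n..<lo - n + (m - n)}" (is "?L \<longleftrightarrow> ?R")
proof
  have up: "bij_betw (\<lambda>b. b + n) {..<m - n} {n..<m}"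
    by (rule bij_betwI[where g = "\<lambda>b. b - n"]) auto
  have up': "bij_betw (\<lambda>b. b + n) {lo - n..<lo - n + (m - n)} {lo..<lo + m - n}"
    by (rule bij_betwI[where g = "\<lambda>b. b - n"]) (use assms in auto)
  have down: "bij_betw (\<lambda>b. b - n) {n..<m} {..<m - n}"
    by (rule bij_betwI[where g = "\<lambda>b. b + n"]) auto
  have down': "bij_betw (\<lambda>b. b - n) {lo..<lo + m - n} {lo - n..<lo - n + (m - n)}"
    by (rule bij_betwI[where g = "\<lambda>b. b + n"]) (use assms in auto)
  {
    assume ?L
    from bij_betw_trans[OF bij_betw_trans[OF up this] down']
    show ?R by (rule bij_betw_cong[THEN iffD1, rotated]) (simp add: edeg_append)
  next
    assume ?R
    from bij_betw_trans[OF bij_betw_trans[OF down this] up']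
    show ?L by (rule bij_betw_cong[THEN iffD1, rotated]) (simp add: edeg_append)
  }
qed

lemma bij_betw_first_run:
  assumes "n \<le> m" "n \<le> lo + m"
  shows "bij_betw (edeg (replicate n (m + lo - n) @ Q)) {..<n} {lo + m - n..<lo + m}"
  by (rule bij_betwI[where g = "\<lambda>v. v - (m + lo - n)"]) (use assms in \<open>auto simp: edeg_append\<close>)

lemma staircase_0: "staircase 0 lo = {[]}"
  by (auto simp: staircase_def is_partition_def bij_betw_def)

text \<open>
  A nonempty row cannot end in degree 0.
\<close>

lemma staircase_low_0: "m \<ge> 1 \<Longrightarrow> staircase m 0 = {}"
proof (rule ccontr)
  assume m: "m \<ge> 1" and "staircase m 0 \<noteq> {}"
  then obtain P where P: "is_partition P" "length P = m" "bij_betw (edeg P) {..<m} {0..<m}"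
    by (auto simp: staircase_def)
  have "0 \<in> edeg P ` {..<m}" using bij_betw_imp_surj_on[OF P(3)] m by auto
  then obtain b where "b < m" "edeg P b = 0" by auto
  thus False using edeg_gt[OF P(1), of b] P(2) by simp
qed

lemma sorted_wrt_replicate_ge: "sorted_wrt (\<ge>) (replicate n (x :: nat))"
  by (induction n) auto

lemma staircase_Cons_run:
  assumes "1 \<le> n" "n \<le> m" "lo \<ge> 1" "Q \<in> staircase (m - n) (lo - n)"
  shows "replicate n (m + lo - n) @ Q \<in> staircase m lo"
proof (cases "n = m")
  case True
  hence "Q = []" using assms by (simp add: staircase_0)
  thus ?thesis using bij_betw_first_run[of n m lo Q] True assms
    by (auto simp: staircase_def is_partition_def sorted_wrt_replicate_ge)
next
  case False
  have lo: "n < lo"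
  proof (rule ccontr)
    assume "\<not> n < lo"
    hence "Q \<in> staircase (m - n) 0" using assms by simp
    thus False using staircase_low_0[of "m - n"] False assms by auto
  qed
  have Q: "is_partition Q" "length Q = m - n" "bij_betw (edeg Q) {..<m - n} {lo - n..<lo - n + (m - n)}"
    using assms by (auto simp: staircase_def)
  let ?P = "replicate n (m + lo - n) @ Q"
  have "x \<le> m + lo - n" if "x \<in> set Q" for x
  proof -
    obtain b where b: "b < length Q" "Q ! b = x" using \<open>x \<in> set Q\<close> unfolding in_set_conv_nth by blast
    have "edeg Q b \<in> {lo - n..<lo - n + (m - n)}" using bij_betw_apply[OF Q(3)] b Q by auto
    thus ?thesis using b by (auto simp: edeg_def nth_default_def)
  qed
  hence "is_partition ?P" using Q(1) lo assms
    by (auto simp: is_partition_def sorted_wrt_append sorted_wrt_replicate_ge)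
  moreover have "bij_betw (edeg ?P) ({..<n} \<union> {n..<m}) ({lo + m - n..<lo + m} \<union> {lo..<lo + m - n})"
    by (rule bij_betw_combine[OF bij_betw_first_run]) (use bij_betw_shift Q(3) lo assms in auto)
  moreover have "{..<n} \<union> {n..<m} = {..<m}" "{lo + m - n..<lo + m} \<union> {lo..<lo + m - n} = {lo..<lo + m}"
    using assms lo by auto
  ultimately show ?thesis using assms Q by (simp add: staircase_def)
qed

text \<open>
  Going back from the row where the largest degree is attained, the end degrees drop by at most one
  in each step and never repeat, hence drop by exactly one. Such rows have equal length.
\<close>

lemma staircase_first_run:
  assumes "P \<in> staircase m lo" "m \<ge> 1" "lo \<ge> 1"
  shows "\<exists>n\<in>{1..m}. \<exists>Q\<in>staircase (m - n) (lo - n). P = replicate n (m + lo - n) @ Q"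
proof -
  have P: "is_partition P" "length P = m" and bij: "bij_betw (edeg P) {..<m} {lo..<lo + m}"
    using assms by (auto simp: staircase_def)
  note surj = bij_betw_imp_surj_on[OF bij] and inj = bij_betw_imp_inj_on[OF bij]
  have "lo + m - 1 \<in> edeg P ` {..<m}" using surj assms by auto
  then obtain b0 where b0: "b0 < m" "edeg P b0 = lo + m - 1" by auto
  have run: "i \<le> b0 \<Longrightarrow> edeg P (b0 - i) + i = lo + m - 1" for i
  proof (induction i rule: less_induct)
    case (less i)
    show ?case
    proof (cases i)
      case 0 thus ?thesis using b0 by simp
    next
      case (Suc j)
      let ?b = "b0 - i"
      have j: "edeg P (Suc ?b) + j = lo + m - 1" using less(1)[of j] less(2) Suc by (simp add: Suc_diff_Suc)
      hence ge: "edeg P ?b + i \<ge> lo + m - 1" using edeg_Suc_le[OF P(1), of ?b] Suc by simp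
      have le: "edeg P ?b \<le> lo + m - 1" using bij_betw_apply[OF bij, of ?b] b0 by force
      show ?thesis
      proof (rule ccontr)
        assume ne: "edeg P ?b + i \<noteq> lo + m - 1"
        define i' where "i' = lo + m - 1 - edeg P ?b"
        have "i' < i" "edeg P ?b + i' = lo + m - 1" unfolding i'_def using ne ge le by linarith+
        hence "edeg P (b0 - i') = edeg P ?b" using less(1)[of i'] less(2) by simp
        hence "b0 - i' = ?b" using inj b0 by (auto simp: inj_on_def)
        thus False using \<open>i' < i\<close> less(2) by simp
      qed
    qed
  qed
  define n where "n = Suc b0"
  define Q where "Q = drop n P"
  have n: "n \<in> {1..m}" using b0 by (simp add: n_def)
  have "P ! b = m + lo - n" if "b < n" for b
    using run[of "b0 - b"] that n P(2) by (auto simp: n_def edeg_def nth_default_def)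
  hence "take n P = replicate n (m + lo - n)" using n P(2) by (intro nth_equalityI) auto
  hence PQ: "P = replicate n (m + lo - n) @ Q" by (metis Q_def append_take_drop_id)
  have pQ: "is_partition Q" using P(1) unfolding Q_def is_partition_def
    by (auto intro: sorted_wrt_drop dest: in_set_dropD)
  have lQ: "length Q = m - n" using P(2) by (simp add: Q_def)
  have "Q \<in> staircase (m - n) (lo - n)"
  proof (cases "n = m")
    case True thus ?thesis using lQ by (simp add: staircase_0)
  next
    case False
    have first: "edeg P ` {..<n} = {lo + m - n..<lo + m}"
      using bij_betw_first_run[of n m lo Q] n unfolding PQ[symmetric] by (simp add: bij_betw_def)
    have "edeg P ` ({..<m} - {..<n}) = edeg P ` {..<m} - edeg P ` {..<n}"
      by (rule inj_on_image_set_diff[OF inj]) (use n in auto)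
    moreover have "{..<m} - {..<n} = {n..<m}" by auto
    moreover have "{lo..<lo + m} - {lo + m - n..<lo + m} = {lo..<lo + m - n}" by auto
    ultimately have im: "edeg P ` {n..<m} = {lo..<lo + m - n}" using first surj by simp
    hence bij2: "bij_betw (edeg P) {n..<m} {lo..<lo + m - n}"
      unfolding bij_betw_def by (auto intro: inj_on_subset[OF inj])
    have "lo \<in> edeg P ` {n..<m}" unfolding im using False n by auto
    then obtain b where "n \<le> b" "b < m" "edeg P b = lo" by auto
    hence "n < lo" using edeg_gt[OF P(1), of b] P(2) by simp
    hence "bij_betw (edeg Q) {..<m - n} {lo - n..<lo - n + (m - n)}"
      using bij2 n bij_betw_shift[of n m lo "m + lo - n" Q] unfolding PQ[symmetric] by auto
    thus ?thesis using pQ lQ by (simp add: staircase_def)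
  qed
  thus ?thesis using n PQ by blast
qed

lemma staircase_rec:
  assumes "m \<ge> 1" "lo \<ge> 1"
  shows "staircase m lo = (\<Union>n\<in>{1..m}. (\<lambda>Q. replicate n (m + lo - n) @ Q) ` staircase (m - n) (lo - n))"
  using staircase_first_run[OF _ assms] staircase_Cons_run[of _ m lo] assms by fastforce

lemma sum_powers_of_two: "(\<Sum>n\<in>{1..<Suc q}. 2 ^ (q - n)) + 1 = (2 ^ q :: nat)"
proof -
  have "(\<Sum>n\<in>{1..<Suc q}. 2 ^ (q - n)) = (\<Sum>i<q. 2 ^ i :: nat)"
    by (rule sum.reindex_bij_witness[of _ "\<lambda>i. q - i" "\<lambda>n. q - n"]) auto
  also have "\<dots> + 1 = 2 ^ q" by (induction q) auto
  finally show ?thesis .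
qed

text \<open>
  The length \<open>n\<close> of the first run can be anything below the smaller of the two parameters, with
  \<open>2\<^bsup>min m lo - n - 1\<^esup>\<close> continuations each, or it can be \<open>m\<close>, with one continuation. The powers of two and
  this 1 add up to the next power of two.
\<close>

theorem card_staircase:
  assumes "m \<ge> 1" "lo \<ge> 1"
  shows "finite (staircase m lo) \<and> card (staircase m lo) = 2 ^ (min m lo - 1)"
  using assms
proof (induction m arbitrary: lo rule: less_induct)
  case (less m)
  let ?f = "\<lambda>n Q. replicate n (m + lo - n) @ Q" and ?X = "\<lambda>n. staircase (m - n) (lo - n)"
  define q where "q = min m lo"
  have X: "finite (?X n) \<and> card (?X n) = (if n = m then 1 else if n < q then 2 ^ (q - 1 - n) else 0)"
    if n: "n \<in> {1..m}" for n
  proof -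
    consider "n = m" | "n < m" "n < lo" | "n < m" "lo \<le> n" using n by force
    thus ?thesis
    proof cases
      case 1 thus ?thesis by (simp add: staircase_0)
    next
      case 2
      hence "min (m - n) (lo - n) - 1 = q - 1 - n" by (auto simp: q_def)
      thus ?thesis using less.IH[of "m - n" "lo - n"] 2 n by (auto simp: q_def)
    next
      case 3 thus ?thesis using staircase_low_0[of "m - n"] by (simp add: q_def)
    qed
  qed
  have disj: "?f n ` ?X n \<inter> ?f n' ` ?X n' = {}" if "n \<in> {1..m}" "n' \<in> {1..m}" "n \<noteq> n'" for n n'
  proof -
    have "hd (?f n Q) = m + lo - n" "hd (?f n' Q) = m + lo - n'" for Q
      using that by (auto simp: hd_append)
    moreover have "m + lo - n \<noteq> m + lo - n'" using that by auto
    ultimately show ?thesis by (metis (no_types, lifting) disjoint_iff imageE)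
  qed
  have fin: "finite (staircase m lo)"
    unfolding staircase_rec[OF less.prems] using X by auto
  have "card (staircase m lo) = (\<Sum>n\<in>{1..m}. card (?f n ` ?X n))"
    unfolding staircase_rec[OF less.prems] using X disj by (intro card_UN_disjoint) auto
  also have "\<dots> = (\<Sum>n\<in>{1..m}. if n = m then 1 else if n < q then 2 ^ (q - 1 - n) else 0)"
    using X by (intro sum.cong refl) (simp add: card_image inj_on_def)
  also have "{1..m} = insert m {1..<m}" using less.prems by auto
  also have "(\<Sum>n\<in>insert m {1..<m}. if n = m then 1 else if n < q then 2 ^ (q - 1 - n) else 0) =
      1 + (\<Sum>n\<in>{1..<m}. if n < q then 2 ^ (q - 1 - n) else 0 :: nat)"
    by (subst sum.insert) (auto intro!: sum.cong)
  also have "(\<Sum>n\<in>{1..<m}. if n < q then 2 ^ (q - 1 - n) else 0 :: nat) = (\<Sum>n\<in>{1..<q}. 2 ^ (q - 1 - n))"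
    by (intro sum.mono_neutral_cong_right) (auto simp: q_def)
  also have "1 + \<dots> = 2 ^ (q - 1)"
    using sum_powers_of_two[of "q - 1"] less.prems by (simp add: q_def)
  finally show ?case using fin by (simp add: q_def)
qed

section \<open>Generators forced by the Hilbert function\<close>

context cell_ideal
begin

lemma form_below_eq_0:
  assumes "f \<in> I" "f \<in> forms v" "{b. b \<le> v \<and> edeg P b \<le> v} = {}"
  shows "f = 0"
proof (rule ccontr)
  assume "f \<noteq> 0"
  from initial_notin_C[OF assms(1,2) this] form_initial(1)[OF assms(2) this]
  have "degree f \<in> {b. b \<le> v \<and> edeg P b \<le> v}" by (auto simp: C_set_iff edeg_def)
  thus False using assms(3) by blast
qed

text \<open>
  For \<open>v < m\<close> the monomial \<open>y\<^sup>v\<close> belongs to the diagram and is not an initial monomial.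
\<close>

lemma no_y_power_below:
  assumes "g \<in> I" "g \<in> forms v" "v < length P"
  shows "coef_xy g (0, v) = 0"
proof (rule ccontr)
  assume nz: "coef_xy g (0, v) \<noteq> 0"
  hence g0: "g \<noteq> 0" by auto
  have "degree g = v"
    by (rule degree_form_eqI[OF nz]) (use formsD[OF assms(2)] in fastforce)
  from initial_notin_C[OF assms(1,2) g0] this have "\<not> 0 < row P v" by (simp add: C_set_iff)
  thus False using row_pos_iff[OF part] assms(3) by simp
qed

text \<open>
  If the exponents outside the diagram in degree \<open>v\<close> are just the multiples of the exponent of \<open>F\<close>,
  then repeated subtraction of multiples of \<open>F\<close> eliminates every form of \<open>I\<close> in this degree.
\<close>

lemma form_multiple:
  assumes F: "F \<in> I" "F \<in> forms e" "coef_xy F (e - b0, b0) = 1" "degree F = b0" "b0 \<le> e"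
    and nb: "{b. b \<le> v \<and> edeg P b \<le> v} = {b0..b0 + (v - e)}" and "e \<le> v"
    and "f \<in> I" "f \<in> forms v"
  shows "\<exists>h\<in>forms (v - e). f = F * h"
  using assms(8,9)
proof (induction "degree f" arbitrary: f rule: less_induct)
  case less
  show ?case
  proof (cases "f = 0")
    case True thus ?thesis by (intro bexI[of _ 0]) auto
  next
    case False
    let ?b = "degree f"
    note init = form_initial[OF less.prems(2) False]
    have "?b \<in> {b. b \<le> v \<and> edeg P b \<le> v}"
      using initial_notin_C[OF less.prems False] init(1) by (auto simp: C_set_iff edeg_def)
    hence b: "b0 \<le> ?b" "?b \<le> b0 + (v - e)" unfolding nb by auto
    define c where "c = coef_xy f (v - ?b, ?b)"
    define h where "h = scal c (mono_xy (v - e - (?b - b0), ?b - b0))"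
    have h: "h \<in> forms (v - e)" unfolding h_def using b by (intro forms_scal forms_mono) auto
    let ?g = "f - F * h"
    have Fh: "F * h \<in> forms v" using forms_mult[OF F(2) h] \<open>e \<le> v\<close> by simp
    have gI: "?g \<in> I" using diff[OF less.prems(1)] mult[OF F(1), of h] by (simp add: mult.commute)
    have gf: "?g \<in> forms v" by (intro forms_diff less.prems Fh)
    have Fhc: "F * h = scal c (mono_xy (v - e - (?b - b0), ?b - b0) * F)" by (simp add: h_def mult.commute)
    have c1: "coef_xy (F * h) (v - ?b, ?b) = c"
    proof -
      have "v - e - (?b - b0) \<le> v - ?b" "v - ?b - (v - e - (?b - b0)) = e - b0"
        using b F(5) \<open>e \<le> v\<close> by linarith+
      thus ?thesis unfolding Fhc using b F(3) by (simp add: coef_xy_mono_mult)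
    qed
    have low: "?g = 0 \<or> degree ?g < ?b"
    proof (rule ccontr)
      assume "\<not> ?thesis"
      hence g: "?g \<noteq> 0" "?b \<le> degree ?g" by auto
      have "degree (F * h) \<le> ?b"
      proof -
        have "degree h \<le> ?b - b0"
          unfolding h_def mono_xy_def prod.case by (rule order_trans[OF degree_smult_le degree_monom_le])
        thus ?thesis using degree_mult_le[of F h] F(4) b by simp
      qed
      hence "degree ?g \<le> ?b" by (intro degree_diff_le) auto
      hence "degree ?g = ?b" using g by simp
      with form_initial(2)[OF gf g(1)] c1 show False by (simp add: c_def)
    qed
    show ?thesis
    proof (cases "?g = 0")
      case True thus ?thesis using h by (intro bexI[of _ h]) auto
    next
      case False
      then obtain h' where h': "h' \<in> forms (v - e)" "?g = F * h'" using less.hyps[OF _ gI gf] low by blast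
      hence "f = F * (h + h')" by (simp add: algebra_simps)
      thus ?thesis using forms_add[OF h h'(1)] by blast
    qed
  qed
qed

end

lemma card_low_rows:
  assumes "card {b. b \<le> v \<and> v < edeg P b} = t"
  shows "card {b. b \<le> v \<and> edeg P b \<le> v} = Suc v - t"
proof -
  have "{b. b \<le> v \<and> edeg P b \<le> v} = {..v} - {b. b \<le> v \<and> v < edeg P b}" by auto
  thus ?thesis using assms by (simp add: card_Diff_subset subset_iff)
qed

context cell_ideal
begin

text \<open>
  In the lowest degree of the ideal all reduced elements are needed as generators. In the other degrees
  of \<open>V\<close>, which are pairwise different, a relation modulo (x, y)I involves a single element by homogeneity.
\<close>

lemma card_low_plus_fresh_le:
  assumes low: "{b. b \<le> d - 1 \<and> edeg P b \<le> d - 1} = {}"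
    and V: "finite V" "V \<inter> C_set P = {}" "inj_on (\<lambda>\<nu>. fst \<nu> + snd \<nu>) V"
      "\<And>\<nu>. \<nu> \<in> V \<Longrightarrow> fst \<nu> + snd \<nu> \<noteq> d" "\<And>\<nu>. \<nu> \<in> V \<Longrightarrow> reduced_elem P I \<nu> \<notin> max_mult I"
  shows "card {b. b \<le> d \<and> edeg P b \<le> d} + card V \<le> min_gens I"
proof -
  let ?r = "reduced_elem P I" and ?low = "{b. b \<le> d \<and> edeg P b \<le> d}"
  \<comment> \<open>the exponents of degree \<open>d\<close> outside the diagram\<close>
  define U where "U = (\<lambda>b. (d - b, b)) ` ?low"
  have U: "finite U" "\<And>\<mu>. \<mu> \<in> U \<Longrightarrow> \<mu> \<notin> C_set P" "\<And>\<mu>. \<mu> \<in> U \<Longrightarrow> fst \<mu> + snd \<mu> = d"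
    by (auto simp: U_def C_set_iff edeg_def)
  have "card U = card ?low" unfolding U_def by (rule card_image) (auto simp: inj_on_def)
  moreover have "U \<inter> V = {}" using U(3) V(4) by blast
  ultimately have "card ?low + card V = card (U \<union> V)" using U(1) V(1) by (simp add: card_Un_disjoint)
  also have "\<dots> \<le> min_gens I"
  proof (rule min_gens_ge, goal_cases)
    case (3 a)
    define s where "s v = (\<Sum>\<mu>\<in>{\<mu> \<in> U \<union> V. fst \<mu> + snd \<mu> = v}. scal (a \<mu>) (?r \<mu>))" for v
    have s: "hom_component v (\<Sum>\<mu>\<in>U \<union> V. scal (a \<mu>) (?r \<mu>)) = s v" for v
    proof -
      have "hom_component v (\<Sum>\<mu>\<in>U \<union> V. scal (a \<mu>) (?r \<mu>)) =
          (\<Sum>\<mu>\<in>U \<union> V. if fst \<mu> + snd \<mu> = v then scal (a \<mu>) (?r \<mu>) else 0)"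
        unfolding hom_component_sum
      proof (intro sum.cong refl)
        fix \<nu> assume "\<nu> \<in> U \<union> V"
        hence "\<nu> \<notin> C_set P" using U V by blast
        from hom_component_form[OF reduced_forms[OF this], of v]
        show "hom_component v (scal (a \<nu>) (?r \<nu>)) = (if fst \<nu> + snd \<nu> = v then scal (a \<nu>) (?r \<nu>) else 0)"
          by (auto simp: hom_component_scal)
      qed
      also have "\<dots> = s v" unfolding s_def using U(1) V(1) by (subst sum.inter_filter[symmetric]) auto
      finally show ?thesis .
    qed
    have "a \<mu> = 0" if \<mu>: "\<mu> \<in> U" for \<mu>
    proof -
      obtain f g where fg: "f \<in> I" "g \<in> I" "f \<in> forms (d - 1)" "g \<in> forms (d - 1)"
          "s d = mono_xy (1, 0) * f + mono_xy (0, 1) * g"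
        using max_mult_hom[OF 3, of d] unfolding s by blast
      have "s d = 0"
        using form_below_eq_0[OF fg(1,3) low] form_below_eq_0[OF fg(2,4) low] fg(5) by simp
      hence "0 = coef_xy (s d) \<mu>" by simp
      also have "\<dots> = (\<Sum>\<nu>\<in>{\<nu>\<in>U \<union> V. fst \<nu> + snd \<nu> = d}. if \<nu> = \<mu> then a \<nu> else 0)"
        unfolding s_def coef_xy_sum
      proof (intro sum.cong refl)
        fix \<nu> assume "\<nu> \<in> {\<nu> \<in> U \<union> V. fst \<nu> + snd \<nu> = d}"
        hence "\<nu> \<notin> C_set P" "\<mu> \<notin> C_set P" using U(2) \<mu> V(2) by blast+
        thus "coef_xy (scal (a \<nu>) (?r \<nu>)) \<mu> = (if \<nu> = \<mu> then a \<nu> else 0)"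
          using coef_reduced by simp
      qed
      also have "\<dots> = a \<mu>" using U(1,3) V(1) \<mu> by simp
      finally show ?thesis by simp
    qed
    moreover have "a \<nu> = 0" if \<nu>: "\<nu> \<in> V" for \<nu>
    proof (rule ccontr)
      assume a: "a \<nu> \<noteq> 0"
      have "{\<mu> \<in> U \<union> V. fst \<mu> + snd \<mu> = fst \<nu> + snd \<nu>} = {\<nu>}"
      proof (intro equalityI subsetI)
        fix \<mu> assume \<mu>: "\<mu> \<in> {\<mu> \<in> U \<union> V. fst \<mu> + snd \<mu> = fst \<nu> + snd \<nu>}"
        hence "\<mu> \<notin> U" using U(3)[of \<mu>] V(4)[OF \<nu>] by auto
        thus "\<mu> \<in> {\<nu>}" using \<mu> inj_onD[OF V(3), of \<mu> \<nu>] \<nu> by auto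
      qed (use \<nu> in auto)
      hence eq: "scal (a \<nu>) (?r \<nu>) = s (fst \<nu> + snd \<nu>)" by (simp add: s_def)
      have "s (fst \<nu> + snd \<nu>) \<in> max_mult I"
        using max_mult_hom[OF 3, of "fst \<nu> + snd \<nu>"] max_mult_I unfolding s by metis
      from max_mult_scal[OF this[folded eq], of "inverse (a \<nu>)"] a V(5)[OF \<nu>] show False
        by (simp add: one_pCons[symmetric])
    qed
    ultimately show ?case by blast
  qed (use U V in auto)
  finally show ?thesis .
qed

lemma reduced_max_mult_forms:
  assumes "\<nu> \<notin> C_set P" "reduced_elem P I \<nu> \<in> max_mult I" "fst \<nu> + snd \<nu> = v"
  shows "\<exists>f\<in>I. \<exists>g\<in>I. f \<in> forms (v - 1) \<and> g \<in> forms (v - 1) \<and>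
    reduced_elem P I \<nu> = mono_xy (1, 0) * f + mono_xy (0, 1) * g"
  using max_mult_hom[OF assms(2), of v] hom_component_form[OF reduced_forms[OF assms(1)], of v] assms(3)
  by auto

lemma y_power_fresh: "reduced_elem P I (0, length P) \<notin> max_mult I" if "length P \<ge> 1"
proof
  assume *: "reduced_elem P I (0, length P) \<in> max_mult I"
  have nC: "(0, length P) \<notin> C_set P" by (simp add: C_set_iff nth_default_def)
  obtain f g where fg: "g \<in> I" "g \<in> forms (length P - 1)"
    "reduced_elem P I (0, length P) = mono_xy (1, 0) * f + mono_xy (0, 1) * g"
    using reduced_max_mult_forms[OF nC *, of "length P"] by auto
  have "1 = coef_xy (reduced_elem P I (0, length P)) (0, length P)"
    using coef_reduced[OF nC nC] by simp
  also have "\<dots> = coef_xy g (0, length P - 1)"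
    unfolding fg(3) using that by (simp add: coef_xy_mono_mult)
  also have "\<dots> = 0" by (rule no_y_power_below[OF fg(1,2)]) (use that in simp)
  finally show False by simp
qed

text \<open>
  Up to degree \<open>w\<close> the ideal consists of the multiples of its single form \<open>F\<close> of degree \<open>d\<close>. In
  degree \<open>w + 1\<close> there are more exponents outside the diagram than multiples of the one of \<open>F\<close>. A
  reduced element at an additional exponent is not a multiple of \<open>F\<close>, since its degree in y is wrong.
\<close>

lemma second_fresh:
  assumes b0: "{b. b \<le> d \<and> edeg P b \<le> d} = {b0}" and "d \<le> w"
    and cw: "card {b. b \<le> w \<and> edeg P b \<le> w} = Suc (w - d)"
    and cw': "card {b. b \<le> Suc w \<and> edeg P b \<le> Suc w} > Suc (Suc (w - d))"
  shows "\<exists>\<nu>. \<nu> \<notin> C_set P \<and> fst \<nu> + snd \<nu> = Suc w \<and> reduced_elem P I \<nu> \<notin> max_mult I"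
proof -
  let ?r = "reduced_elem P I"
  define low where "low v = {b. b \<le> v \<and> edeg P b \<le> v}" for v
  have fin_low: "finite (low v)" for v by (simp add: low_def)
  have b0d: "b0 \<le> d" "edeg P b0 \<le> d" using b0 by auto
  have nC0: "(d - b0, b0) \<notin> C_set P" using b0d by (auto simp: C_set_iff edeg_def)
  define F where "F = ?r (d - b0, b0)"
  have F: "F \<in> I" "F \<in> forms d" "coef_xy F (d - b0, b0) = 1" "degree F = b0"
    using reduced_in[OF nC0] reduced_forms[OF nC0] coef_reduced[OF nC0 nC0] degree_reduced[OF nC0] b0d
    by (auto simp: F_def)
  have "{b0..b0 + (w - d)} \<subseteq> low w"
  proof
    fix b assume b: "b \<in> {b0..b0 + (w - d)}"
    have "(w - b, b) \<notin> C_set P"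
      by (rule notin_C_set_mono[OF part nC0]) (use b b0d \<open>d \<le> w\<close> in auto)
    moreover have "b \<le> w" using b b0d \<open>d \<le> w\<close> by auto
    ultimately show "b \<in> low w" by (auto simp: low_def C_set_iff edeg_def)
  qed
  hence low_w: "low w = {b0..b0 + (w - d)}"
    using cw by (intro card_subset_eq[symmetric] fin_low) (auto simp: low_def)
  have "\<not> low (Suc w) \<subseteq> {b0..b0 + Suc (w - d)}"
    using card_mono[of "{b0..b0 + Suc (w - d)}" "low (Suc w)"] cw' by (auto simp: low_def)
  then obtain b1 where b1: "b1 \<in> low (Suc w)" "b1 \<notin> {b0..b0 + Suc (w - d)}" by blast
  let ?\<nu> = "(Suc w - b1, b1)"
  have nC1: "?\<nu> \<notin> C_set P" and b1w: "b1 \<le> Suc w" using b1(1) by (auto simp: low_def C_set_iff edeg_def)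
  have "?r ?\<nu> \<notin> max_mult I"
  proof
    assume *: "?r ?\<nu> \<in> max_mult I"
    obtain f g where fg: "f \<in> I" "g \<in> I" "f \<in> forms w" "g \<in> forms w"
      "?r ?\<nu> = mono_xy (1, 0) * f + mono_xy (0, 1) * g"
      using reduced_max_mult_forms[OF nC1 *, of "Suc w"] b1w by auto
    note mult = form_multiple[OF F b0d(1) low_w[unfolded low_def] \<open>d \<le> w\<close>]
    obtain h h' where h: "h \<in> forms (w - d)" "f = F * h" "h' \<in> forms (w - d)" "g = F * h'"
      using mult[OF fg(1,3)] mult[OF fg(2,4)] by blast
    define q where "q = mono_xy (1, 0) * h + mono_xy (0, 1) * h'"
    have q: "q \<in> forms (Suc (w - d))"
      unfolding q_def using forms_mono_mult[OF h(1), of 1 0] forms_mono_mult[OF h(3), of 0 1]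
      by (intro forms_add) auto
    have eq: "?r ?\<nu> = F * q" unfolding fg(5) h(2,4) q_def distrib_left by (simp only: mult.left_commute)
    have "?r ?\<nu> \<noteq> 0" using coef_reduced[OF nC1 nC1] by auto
    hence nz: "F \<noteq> 0" "q \<noteq> 0" unfolding eq by auto
    have "b1 = degree (?r ?\<nu>)" using degree_reduced[OF nC1] by simp
    also have "\<dots> = b0 + degree q" unfolding eq using nz F(4) by (simp add: degree_mult_eq)
    finally show False using b1(2) form_initial(1)[OF q nz(2)] by auto
  qed
  thus ?thesis using nC1 b1w by (intro exI[of _ ?\<nu>]) auto
qed

text \<open>
  Degree \<open>d\<close> contributes one generator, or two if \<open>k = 1\<close>; for \<open>k \<ge> 2\<close> a second one comes from degree
  \<open>d + k - 1\<close>. The degree of \<open>y\<^sup>m\<close>, where \<open>m\<close> is the length of \<open>P\<close>, contributes a third one unless it is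
  one of these two degrees.
\<close>

lemma min_gens_lower_bound:
  assumes d: "d \<ge> 2" "k \<ge> 1"
    and T: "\<And>i. card {b. b \<le> i \<and> i < edeg P b} = min (min (Suc i) d) (2 * d + k - 2 - i)"
  shows "2 \<le> min_gens I" "length P \<notin> {d, d + k - 1} \<Longrightarrow> 3 \<le> min_gens I"
proof -
  define low where "low v = {b. b \<le> v \<and> edeg P b \<le> v}" for v
  have card_low: "card (low v) = Suc v - min (min (Suc v) d) (2 * d + k - 2 - v)" for v
    unfolding low_def by (rule card_low_rows[OF T])
  have "finite (low (d - 1))" by (simp add: low_def)
  moreover have "card (low (d - 1)) = 0" unfolding card_low using d by simp
  ultimately have low0: "low (d - 1) = {}" by simp
  have len: "d \<le> length P"
  proof (rule ccontr)
    assume "\<not> d \<le> length P"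
    hence "d - 1 \<in> low (d - 1)" using edeg_beyond[of P "d - 1"] by (simp add: low_def)
    thus False using low0 by simp
  qed
  note bound = card_low_plus_fresh_le[of d, folded low_def, OF low0]
  let ?y = "(0, length P)"
  have y: "?y \<notin> C_set P" "reduced_elem P I ?y \<notin> max_mult I"
    using y_power_fresh len d by (auto simp: C_set_iff nth_default_def)
  have "2 \<le> min_gens I \<and> (length P \<notin> {d, d + k - 1} \<longrightarrow> 3 \<le> min_gens I)"
  proof (cases "k = 1")
    case True
    hence "card (low d) = 2" unfolding card_low using d by simp
    thus ?thesis using bound[of "{}"] bound[of "{?y}"] y by auto
  next
    case False
    define w where "w = d + k - 2"
    have w: "d \<le> w" "w - d = k - 2" "d + k - 1 = Suc w" using d False by (auto simp: w_def)
    have "card (low d) = 1" unfolding card_low using d False by simp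
    then obtain b0 where b0: "low d = {b0}" by (auto simp: card_1_singleton_iff)
    have "card (low w) = Suc (w - d)" unfolding card_low using d False w by (simp add: w_def)
    moreover have "card (low (Suc w)) = Suc k"
    proof -
      have "2 * d + k - 2 - Suc w = d - 1" using d False by (simp add: w_def)
      moreover have "Suc (Suc w) - (d - 1) = Suc k" using d False by (simp add: w_def)
      moreover have "min (min (Suc (Suc w)) d) (d - 1) = d - 1" using w by simp
      ultimately show ?thesis unfolding card_low by simp
    qed
    moreover have "Suc (k - 2) < k" using False d by linarith
    ultimately obtain \<nu> where \<nu>: "\<nu> \<notin> C_set P" "fst \<nu> + snd \<nu> = Suc w" "reduced_elem P I \<nu> \<notin> max_mult I"
      using second_fresh[of d b0 w, folded low_def] b0 w False d by auto
    have "2 \<le> min_gens I"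
      using bound[of "{\<nu>}"] \<nu> w \<open>card (low d) = 1\<close> by auto
    moreover have "3 \<le> min_gens I" if len': "length P \<notin> {d, d + k - 1}"
    proof -
      have ne: "length P \<noteq> Suc w" "length P \<noteq> d" using len' w by auto
      hence "\<nu> \<noteq> ?y" using \<nu>(2) by auto
      hence "card {\<nu>, ?y} = 2" by simp
      moreover have "card (low d) + card {\<nu>, ?y} \<le> min_gens I"
        by (rule bound) (use \<nu> y ne w in \<open>auto simp: inj_on_def\<close>)
      ultimately show ?thesis using \<open>card (low d) = 1\<close> by simp
    qed
    ultimately show ?thesis by blast
  qed
  thus "2 \<le> min_gens I" "length P \<notin> {d, d + k - 1} \<Longrightarrow> 3 \<le> min_gens I" by auto
qed

end

section \<open>A complete intersection in the cell\<close>

text \<open>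
  The coefficients link every row to the row that ends one degree later, if that row does not come
  next anyway. A row \<open>j\<close> following a row \<open>b\<close> with \<open>e\<^sub>j = e\<^sub>b + 1\<close> must be the next one, because the
  end degrees rise by at most one and would otherwise take the value \<open>e\<^sub>j\<close> earlier. By induction on
  the end degree, all generators belong to the ideal of the one of least degree and the first one that is
  monic in y.
\<close>

lemma staircase_complete_intersection:
  assumes P: "P \<in> staircase m lo" and m: "m \<ge> 1"
  shows "\<exists>I :: 'a::field poly poly set. I \<in> jordan_cell P \<and> min_gens I \<le> 2"
proof -
  have part: "is_partition P" and len: "length P = m" and bij: "bij_betw (edeg P) {..<m} {lo..<lo + m}"
    using P by (auto simp: staircase_def)
  note inj = bij_betw_imp_inj_on[OF bij]
  define c :: "nat \<Rightarrow> nat \<Rightarrow> 'a" where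
    "c b j = (if b < m \<and> j \<le> b \<and> edeg P j = Suc (edeg P b) then 1 else 0)" for b j
  have c: "admissible_coeffs P c" by (auto simp: admissible_coeffs_def c_def)
  let ?F = "recur_gen P c" and ?y = "mono_xy (0, 1) :: 'a poly poly"
  note rel = recur_relation[OF part c]
  have "lo \<in> edeg P ` {..<m}" using bij_betw_imp_surj_on[OF bij] m by auto
  then obtain j0 where j0: "j0 < m" "edeg P j0 = lo" by auto
  define N where "N = ideal_gen {?F j0, ?F m}"
  have N: "is_ideal N" by (simp add: N_def)
  have FN: "?F j0 \<in> N" "?F m \<in> N" unfolding N_def using ideal_gen_superset by blast+
  have below: "?F j \<in> N" if "j < m" for j
    using that
  proof (induction "edeg P j" arbitrary: j rule: less_induct)
    case less
    show ?case
    proof (cases "edeg P j = lo")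
      case True
      hence "j = j0" using inj j0 less.prems by (auto simp: inj_on_def)
      thus ?thesis using FN by simp
    next
      case False
      have ej: "lo < edeg P j" "edeg P j < lo + m" using bij_betw_apply[OF bij, of j] less.prems False by auto
      hence "edeg P j - 1 \<in> edeg P ` {..<m}" using bij_betw_imp_surj_on[OF bij] by auto
      then obtain b where b: "b < m" "edeg P b = edeg P j - 1" by auto
      hence eb: "edeg P j = Suc (edeg P b)" using ej by simp
      have Fb: "?F b \<in> N" using less.hyps[of b] b ej by simp
      have uniq: "c b i = (if i = j \<and> j \<le> b then 1 else 0)" if "i \<le> b" for i
        using that b eb less.prems inj by (auto simp: c_def inj_on_def)
      have sum: "(\<Sum>i\<le>b. smult (monom (c b i) (edeg P b + 1 - edeg P i)) (?F i)) = (if j \<le> b then ?F j else 0)"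
      proof -
        have "(\<Sum>i\<le>b. smult (monom (c b i) (edeg P b + 1 - edeg P i)) (?F i)) =
            (\<Sum>i\<le>b. if i = j then ?F j else 0)"
          using uniq eb by (intro sum.cong refl) (auto simp: monom_0 one_pCons[symmetric])
        thus ?thesis by simp
      qed
      show ?thesis
      proof (cases "j \<le> b")
        case True
        have "?F (Suc b) \<in> N"
        proof (cases "Suc b = m")
          case False
          hence "Suc b < m" using b by simp
          moreover have "edeg P (Suc b) \<noteq> edeg P j"
            using inj_onD[OF inj, of "Suc b" j] \<open>Suc b < m\<close> less.prems True by auto
          ultimately show ?thesis using edeg_Suc_le[OF part, of b] eb less.hyps[of "Suc b"] by simp
        qed (use FN in simp)
        moreover have "?F j = smult (monom 1 (row P b - row P (Suc b))) (?F (Suc b)) - ?y * ?F b"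
          using rel[of b] sum True by simp
        ultimately show ?thesis using Fb ideal_diff[OF N ideal_smult[OF N] ideal_mult[OF N]] by metis
      next
        case False
        have "j = Suc b"
        proof (rule ccontr)
          assume "j \<noteq> Suc b"
          hence j: "Suc b < j" using False by simp
          have "edeg P (b + i) < edeg P j" if "b + i < j" for i
            using that
          proof (induction i)
            case 0 thus ?case using eb by simp
          next
            case (Suc i)
            hence "edeg P (b + Suc i) \<le> edeg P j" using edeg_Suc_le[OF part, of "b + i"] by simp
            moreover have "edeg P (b + Suc i) \<noteq> edeg P j"
              using inj Suc.prems less.prems by (auto simp: inj_on_def)
            ultimately show ?case by simp
          qed
          from this[of "j - 1 - b"] have "edeg P (j - 1) < edeg P j" using j by simp
          moreover have "edeg P j \<le> Suc (edeg P (j - 1))" using edeg_Suc_le[OF part, of "j - 1"] j by simp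
          ultimately have "edeg P (j - 1) = edeg P b" using eb by simp
          hence "j - 1 = b" using inj j less.prems b by (auto simp: inj_on_def)
          thus False using j by simp
        qed
        moreover have "row P b - row P (Suc b) = 0" using eb \<open>j = Suc b\<close> by (simp add: edeg_def)
        ultimately have "?F j = ?y * ?F b" using rel[of b] sum False by (simp add: monom_0 one_pCons[symmetric])
        thus ?thesis using ideal_mult[OF N Fb] by simp
      qed
    qed
  qed
  have above: "?F (m + i) \<in> N" for i
  proof (induction i)
    case (Suc i)
    have "?F (Suc (m + i)) = ?y * ?F (m + i)"
      using rel[of "m + i"] len by (simp add: c_def nth_default_def monom_0 one_pCons[symmetric])
    thus ?case using ideal_mult[OF N Suc, of ?y] by simp
  qed (use FN in simp)
  have "?F j \<in> N" for j using below[of j] above[of "j - m"] by (cases "j < m") auto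
  hence "recur_ideal P c \<subseteq> N" unfolding recur_ideal_def by (intro ideal_gen_least N) auto
  moreover have "N \<subseteq> recur_ideal P c" unfolding N_def
    by (intro ideal_gen_least is_ideal_recur_ideal) (auto intro: recur_gen_in)
  ultimately have "min_gens (recur_ideal P c) \<le> card {?F j0, ?F m}"
    unfolding N_def by (intro min_gens_le) auto
  also have "\<dots> \<le> 2" by (rule card_insert_le_m1) auto
  finally show ?thesis using recur_ideal_in_cell[OF part c] by blast
qed

section \<open>The count\<close>

lemma jordan_cell_nonempty:
  assumes "is_partition P"
  shows "(jordan_cell P :: 'a::field poly poly set set) \<noteq> {}"
  using recur_ideal_in_cell[OF assms, of "\<lambda>_ _. 0"] by (auto simp: admissible_coeffs_def)

lemma admissible_field_infinite:
  assumes "admissible_field TYPE('a::field) T"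
  shows "infinite (UNIV :: 'a set)"
  using assms finite_imp_CHAR_pos[where 'a = 'a] by (auto simp: admissible_field_def)

text \<open>
  An ideal with the fewest generators in the cell decides: by the lower bound it has at least two, and
  more unless the length of \<open>P\<close> is right, in which case the cell contains a complete intersection.
\<close>

theorem CI_jordan_types_eq:
  assumes "admissible_field TYPE('a::field) (T_seq d k)" "d \<ge> 2" "k \<ge> 1"
  shows "CI_jordan_types TYPE('a) (T_seq d k) = staircase d (d + k - 1) \<union> staircase (d + k - 1) d"
proof (rule set_eqI)
  fix P
  note inf = admissible_field_infinite[OF assms(1)]
  have stair: "P \<in> staircase m lo \<longleftrightarrow> length P = m \<and> has_diagonal_lengths TYPE('a) P (T_seq d k)"
    if "is_partition P" "min m lo = d" "m + lo = 2 * d + k - 1" for m lo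
  proof (cases "length P = m")
    case True
    have "m \<ge> 1" "lo \<ge> 1" using that assms by auto
    moreover have "2 * d + k - 2 - i = m + lo - 1 - i" for i using that(3) by simp
    ultimately show ?thesis
      using diagonal_lengths_iff_staircase[OF that(1) True, of lo]
        has_diagonal_lengths_iff[OF that(1), of d k "TYPE('a)"] that True assms by simp
  qed (auto simp: staircase_def)
  have eq: "P \<in> staircase d (d + k - 1) \<union> staircase (d + k - 1) d \<longleftrightarrow>
      length P \<in> {d, d + k - 1} \<and> has_diagonal_lengths TYPE('a) P (T_seq d k)" if "is_partition P"
    using stair[OF that, of d "d + k - 1"] stair[OF that, of "d + k - 1" d] assms by auto
  show "P \<in> CI_jordan_types TYPE('a) (T_seq d k) \<longleftrightarrow> P \<in> staircase d (d + k - 1) \<union> staircase (d + k - 1) d"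
  proof (cases "is_partition P \<and> has_diagonal_lengths TYPE('a) P (T_seq d k)")
    case False
    thus ?thesis using eq by (auto simp: CI_jordan_types_def staircase_def)
  next
    case True
    obtain I0 :: "'a poly poly set" where I0: "I0 \<in> jordan_cell P"
      and least: "\<And>I. I \<in> jordan_cell P \<Longrightarrow> min_gens I0 \<le> min_gens (I :: 'a poly poly set)"
    proof -
      obtain I1 :: "'a poly poly set" where "I1 \<in> jordan_cell P" using jordan_cell_nonempty True by blast
      from ex_has_least_nat[of "\<lambda>I. I \<in> jordan_cell P", OF this, of min_gens] show ?thesis
        by (elim exE conjE) (rule that, auto)
    qed
    have kappa: "kappa TYPE('a) P = min_gens I0"
      using kappa_eq_min[OF inf _ I0 least] True by blast
    interpret cell_ideal P I0 by standard (use True I0 in auto)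
    have T: "card {b. b \<le> i \<and> i < edeg P b} = min (min (Suc i) d) (2 * d + k - 2 - i)" for i
      using True has_diagonal_lengths_iff[of P d k] assms by auto
    note lower = min_gens_lower_bound[OF assms(2,3) T]
    have "min_gens I0 = 2 \<longleftrightarrow> length P \<in> {d, d + k - 1}"
    proof
      assume "min_gens I0 = 2" thus "length P \<in> {d, d + k - 1}" using lower(2) by auto
    next
      assume "length P \<in> {d, d + k - 1}"
      hence "P \<in> staircase d (d + k - 1) \<union> staircase (d + k - 1) d" using eq True by blast
      moreover have ge1: "d \<ge> 1" "d + k - 1 \<ge> 1" using assms by linarith+
      ultimately obtain I :: "'a poly poly set" where "I \<in> jordan_cell P" "min_gens I \<le> 2"
        using staircase_complete_intersection[of P d "d + k - 1"]
          staircase_complete_intersection[of P "d + k - 1" d] ge1 by auto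
      thus "min_gens I0 = 2" using least[of I] lower(1) by simp
    qed
    thus ?thesis using eq True kappa by (auto simp: CI_jordan_types_def)
  qed
qed

theorem corollary6p4:
  fixes d :: nat
  assumes "d \<ge> 2"
  shows
    "(admissible_field TYPE('a::field) (T_seq d 1) \<longrightarrow>
        card (CI_jordan_types TYPE('a) (T_seq d 1)) = 2 ^ (d - 1)) \<and>
     (\<forall>k\<ge>2. admissible_field TYPE('a) (T_seq d k) \<longrightarrow>
        card (CI_jordan_types TYPE('a) (T_seq d k)) = 2 ^ d)"
proof (intro conjI impI allI)
  assume "admissible_field TYPE('a) (T_seq d 1)"
  thus "card (CI_jordan_types TYPE('a) (T_seq d 1)) = 2 ^ (d - 1)"
    using CI_jordan_types_eq[of d 1, where 'a = 'a] card_staircase[of d d] assms by simp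
next
  fix k :: nat
  assume k: "k \<ge> 2" and adm: "admissible_field TYPE('a) (T_seq d k)"
  have "staircase d (d + k - 1) \<inter> staircase (d + k - 1) d = {}"
    using k by (auto simp: staircase_def)
  moreover have "finite (staircase d (d + k - 1))" "card (staircase d (d + k - 1)) = 2 ^ (d - 1)"
    "finite (staircase (d + k - 1) d)" "card (staircase (d + k - 1) d) = 2 ^ (d - 1)"
    using card_staircase[of d "d + k - 1"] card_staircase[of "d + k - 1" d] assms k by auto
  ultimately have "card (CI_jordan_types TYPE('a) (T_seq d k)) = 2 ^ (d - 1) + 2 ^ (d - 1)"
    using CI_jordan_types_eq[OF adm assms] k by (simp add: card_Un_disjoint)
  also have "\<dots> = 2 ^ d" using assms by (cases d) auto
  finally show "card (CI_jordan_types TYPE('a) (T_seq d k)) = 2 ^ d" .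
qed

end
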